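(* Let $M^2$ be a 2-dimensional Riemannian manifold with sign-preserving curvature, and let $TM^2$ be its tangent bundle endowed with the Sasaki metric. Then $TM^2$ does not admit a totally geodesic 3-dimensional submanifold, even locally (i.e. no open subset of $TM^2$ contains a nonempty 3-dimensional totally geodesic submanifold).
   Context: Sign-preserving curvature means that the Gaussian curvature is either everywhere positive or everywhere negative on $M^2$. Let $\pi:TM\to M$ be the bundle projection of the tangent bundle of a Riemannian manifold $(M,g)$. The Sasaki metric on $TM$ is $\langle\langle \tilde X,\tilde Y\rangle\rangle=\langle \pi_*\tilde X,\pi_*\tilde Y\rangle+\langle \mathcal K\tilde X,\mathcal K\tilde Y\rangle$, where $\langle\cdot,\cdot\rangle=g$ and $\mathcal K:TTM\to TM$ is the connection map; in induced local coordinates $(x^i,\xi^i)$ on $TM$, for $\tilde X=\tilde X^i\frac{\partial}{\partial x^i}+\tilde X^{n+i}\frac{\partial}{\partial \xi^i}$ at the point $(q,\xi)$, one has $\pi_*\tilde X=\tilde X^i\partial_i$ and $\mathcal K\tilde X=(\tilde X^{n+i}+\Gamma^i_{jk}(q)\xi^j\tilde X^k)\partial_i$. *)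

theory Defs
  imports "HOL-Analysis.Analysis"
begin

section \<open>Smooth maps between open subsets of Euclidean spaces\<close>

(* Both notions are meant for an open set S, so that the unrestricted "at x" is the right filter. *)
primrec C_k_on :: "nat \<Rightarrow> 'a::euclidean_space set \<Rightarrow> ('a \<Rightarrow> 'b::real_normed_vector) \<Rightarrow> bool" where
  "C_k_on 0 S f \<longleftrightarrow> continuous_on S f"
| "C_k_on (Suc k) S f \<longleftrightarrow>
     (\<forall>x\<in>S. f differentiable (at x)) \<and>
     (\<forall>v. C_k_on k S (\<lambda>x. frechet_derivative f (at x) v))"

definition smooth_on :: "'a::euclidean_space set \<Rightarrow> ('a \<Rightarrow> 'b::real_normed_vector) \<Rightarrow> bool" where
  "smooth_on S f \<longleftrightarrow> (\<forall>k. C_k_on k S f)"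

definition partial :: "'n::finite \<Rightarrow> (real^'n \<Rightarrow> 'b::real_normed_vector) \<Rightarrow> real^'n \<Rightarrow> 'b" where
  "partial i f x = frechet_derivative f (at x) (axis i 1)"

section \<open>Smooth manifolds\<close>

(* A manifold is given by an atlas. A chart is its domain together with a coordinate map, of which
   only the values on the domain matter. *)
type_synonym ('p, 'n) chart = "'p set \<times> ('p \<Rightarrow> real^'n)"

definition carrier :: "('p, 'n::finite) chart set \<Rightarrow> 'p set" where
  "carrier A = (\<Union>c\<in>A. fst c)"

definition chart_image :: "('p, 'n::finite) chart \<Rightarrow> (real^'n) set" where
  "chart_image c = snd c ` fst c"

definition chart_inv :: "('p, 'n::finite) chart \<Rightarrow> real^'n \<Rightarrow> 'p" where
  "chart_inv c = inv_into (fst c) (snd c)"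

definition transition :: "('p, 'n::finite) chart \<Rightarrow> ('p, 'm::finite) chart \<Rightarrow> real^'n \<Rightarrow> real^'m" where
  "transition c d = snd d \<circ> chart_inv c"

(* The unique topology for which all chart domains are open and all charts are homeomorphisms
   onto their images. *)
definition atlas_topology :: "('p, 'n::finite) chart set \<Rightarrow> 'p topology" where
  "atlas_topology A = topology_generated_by {fst c \<inter> snd c -` V | c V. c \<in> A \<and> open V}"

definition smooth_manifold :: "('p, 'n::finite) chart set \<Rightarrow> bool" where
  "smooth_manifold A \<longleftrightarrow>
     (\<forall>c\<in>A. inj_on (snd c) (fst c) \<and> open (chart_image c)) \<and>
     (\<forall>c\<in>A. \<forall>d\<in>A. open (snd c ` (fst c \<inter> fst d)) \<and>
        smooth_on (snd c ` (fst c \<inter> fst d)) (transition c d)) \<and>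
     Hausdorff_space (atlas_topology A) \<and>
     second_countable (atlas_topology A)"

section \<open>The tangent bundle\<close>

(* A tangent vector at p is the family of its component vectors in all charts around p, related by
   the Jacobians of the transition maps. Indices outside the charts around p carry the dummy 0. *)
type_synonym ('p, 'n) tangent_vector = "('p, 'n) chart \<Rightarrow> real^'n"

definition tangent_space ::
  "('p, 'n::finite) chart set \<Rightarrow> 'p \<Rightarrow> ('p, 'n) tangent_vector set" where
  "tangent_space A p =
     {v. (\<forall>c\<in>A. \<forall>d\<in>A. p \<in> fst c \<inter> fst d \<longrightarrow>
            v d = frechet_derivative (transition c d) (at (snd c p)) (v c)) \<and>
         (\<forall>c. \<not> (c \<in> A \<and> p \<in> fst c) \<longrightarrow> v c = 0)}"

type_synonym ('p, 'n) tangent_point = "'p \<times> ('p, 'n) tangent_vector"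

definition tangent_bundle ::
  "('p, 'n::finite) chart set \<Rightarrow> ('p, 'n) tangent_point set" where
  "tangent_bundle A = Sigma (carrier A) (tangent_space A)"

(* In the induced coordinates on the tangent bundle, the index Inl i stands for x^i and the index
   Inr i for xi^i. *)
definition base_part :: "real^('n + 'n) \<Rightarrow> real^('n::finite)" where
  "base_part z = (\<chi> i. z $ Inl i)"

definition fibre_part :: "real^('n + 'n) \<Rightarrow> real^('n::finite)" where
  "fibre_part z = (\<chi> i. z $ Inr i)"

definition tangent_chart ::
  "('p, 'n::finite) chart set \<Rightarrow> ('p, 'n) chart \<Rightarrow> (('p, 'n) tangent_point, 'n + 'n) chart" where
  "tangent_chart A c =
     ({(p, v) \<in> tangent_bundle A. p \<in> fst c},
      \<lambda>(p, v). \<chi> a. case a of Inl i \<Rightarrow> snd c p $ i | Inr i \<Rightarrow> v c $ i)"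

definition tangent_atlas ::
  "('p, 'n::finite) chart set \<Rightarrow> (('p, 'n) tangent_point, 'n + 'n) chart set" where
  "tangent_atlas A = tangent_chart A ` A"

section \<open>Riemannian metrics\<close>

(* "g c x u w" is the inner product, at the point with coordinates x in the chart c, of the
   tangent vectors with components u and w in c. *)
type_synonym ('p, 'n) metric_field = "('p, 'n) chart \<Rightarrow> real^'n \<Rightarrow> real^'n \<Rightarrow> real^'n \<Rightarrow> real"

definition riemannian_metric ::
  "('p, 'n::finite) chart set \<Rightarrow> ('p, 'n) metric_field \<Rightarrow> bool" where
  "riemannian_metric A g \<longleftrightarrow>
     (\<forall>c\<in>A. \<forall>x\<in>chart_image c.
        bilinear (g c x) \<and> (\<forall>u w. g c x u w = g c x w u) \<and> (\<forall>u. u \<noteq> 0 \<longrightarrow> g c x u u > 0)) \<and>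
     (\<forall>c\<in>A. \<forall>u w. smooth_on (chart_image c) (\<lambda>x. g c x u w)) \<and>
     (\<forall>c\<in>A. \<forall>d\<in>A. \<forall>x \<in> snd c ` (fst c \<inter> fst d). \<forall>u w.
        g c x u w =
        g d (transition c d x) (frechet_derivative (transition c d) (at x) u)
                               (frechet_derivative (transition c d) (at x) w))"

definition metric_coeff ::
  "('p, 'n::finite) metric_field \<Rightarrow> ('p, 'n) chart \<Rightarrow> 'n \<Rightarrow> 'n \<Rightarrow> real^'n \<Rightarrow> real" where
  "metric_coeff g c i j x = g c x (axis i 1) (axis j 1)"

(* christoffel g c i j k x is Gamma^i_jk at x *)
definition christoffel ::
  "('p, 'n::finite) metric_field \<Rightarrow> ('p, 'n) chart \<Rightarrow> 'n \<Rightarrow> 'n \<Rightarrow> 'n \<Rightarrow> real^'n \<Rightarrow> real" where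
  "christoffel g c i j k x =
     (1/2) * (\<Sum>l\<in>UNIV. matrix_inv (\<chi> a b. metric_coeff g c a b x) $ i $ l *
        (partial j (metric_coeff g c k l) x + partial k (metric_coeff g c j l) x
          - partial l (metric_coeff g c j k) x))"

(* Components of R(d_i, d_j) d_k for R(X,Y)Z = D_X D_Y Z - D_Y D_X Z - D_[X,Y] Z. *)
definition riemann_curvature ::
  "('p, 'n::finite) metric_field \<Rightarrow> ('p, 'n) chart \<Rightarrow> 'n \<Rightarrow> 'n \<Rightarrow> 'n \<Rightarrow> real^'n \<Rightarrow> real^'n" where
  "riemann_curvature g c i j k x =
     (\<chi> l. partial i (christoffel g c l j k) x - partial j (christoffel g c l i k) x
        + (\<Sum>m\<in>UNIV. christoffel g c m j k x * christoffel g c l i m x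
                     - christoffel g c m i k x * christoffel g c l j m x))"

(* Gaussian curvature does not depend on the chart used to compute it. *)
definition gaussian_curvature ::
  "('p, 2) chart set \<Rightarrow> ('p, 2) metric_field \<Rightarrow> 'p \<Rightarrow> real" where
  "gaussian_curvature A g p =
     (let c = (SOME c. c \<in> A \<and> p \<in> fst c); x = snd c p in
        g c x (riemann_curvature g c 1 2 2 x) (axis 1 1) /
        (metric_coeff g c 1 1 x * metric_coeff g c 2 2 x - (metric_coeff g c 1 2 x)\<^sup>2))"

definition sign_preserving_curvature ::
  "('p, 2) chart set \<Rightarrow> ('p, 2) metric_field \<Rightarrow> bool" where
  "sign_preserving_curvature A g \<longleftrightarrow>
     (\<forall>p\<in>carrier A. gaussian_curvature A g p > 0) \<or>
     (\<forall>p\<in>carrier A. gaussian_curvature A g p < 0)"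

section \<open>The Sasaki metric\<close>

(* The connection map TTM -> TM in the coordinates induced by c, at the point with coordinates z.
   The differential of the bundle projection is base_part in these coordinates. *)
definition connection_map ::
  "('p, 'n::finite) metric_field \<Rightarrow> ('p, 'n) chart \<Rightarrow> real^('n + 'n) \<Rightarrow> real^('n + 'n) \<Rightarrow> real^'n" where
  "connection_map g c z X =
     (\<chi> i. X $ Inr i +
        (\<Sum>j\<in>UNIV. \<Sum>k\<in>UNIV. christoffel g c i j k (base_part z) * z $ Inr j * X $ Inl k))"

(* The chart argument C is the induced chart tangent_chart A c; c is recovered from it. *)
definition sasaki_metric ::
  "('p, 'n::finite) chart set \<Rightarrow> ('p, 'n) metric_field \<Rightarrow> (('p, 'n) tangent_point, 'n + 'n) metric_field" where
  "sasaki_metric A g C z X Y =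
     (let c = inv (tangent_chart A) C in
        g c (base_part z) (base_part X) (base_part Y) +
        g c (base_part z) (connection_map g c z X) (connection_map g c z Y))"

lemma inj_tangent_chart:
  "inj (tangent_chart A :: ('p, 'n::finite) chart \<Rightarrow> _)"
proof (rule injI)
  fix c d :: "('p, 'n) chart"
  assume eq: "tangent_chart A c = tangent_chart A d"
  define v :: "('p, 'n) tangent_vector" where "v = (\<lambda>e. if e = c then 1 else 0)"
  have "snd (tangent_chart A c) (undefined, v) $ Inr undefined
      = snd (tangent_chart A d) (undefined, v) $ Inr undefined"
    using eq by simp
  then have "v c $ undefined = v d $ undefined"
    by (simp add: tangent_chart_def)
  then show "c = d"
    by (simp add: v_def split: if_splits)
qed

lemma sasaki_metric_tangent_chart:
  "sasaki_metric A g (tangent_chart A c) z X Y =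
     g c (base_part z) (base_part X) (base_part Y) +
     g c (base_part z) (connection_map g c z X) (connection_map g c z Y)"
  by (simp add: sasaki_metric_def inj_tangent_chart Let_def)

section \<open>Totally geodesic submanifolds\<close>

(* The submanifold is the set carrier B with its own smooth structure B, such that the inclusion
   is a smooth immersion. Embedded submanifolds are the case in which the topology of B is the
   subspace topology. *)
definition submanifold ::
  "('p, 'n::finite) chart set \<Rightarrow> ('p, 'k::finite) chart set \<Rightarrow> bool" where
  "submanifold A B \<longleftrightarrow>
     smooth_manifold B \<and> carrier B \<subseteq> carrier A \<and>
     (\<forall>b\<in>B. \<forall>c\<in>A.
        open (snd b ` (fst b \<inter> fst c)) \<and>
        smooth_on (snd b ` (fst b \<inter> fst c)) (transition b c) \<and>
        (\<forall>y \<in> snd b ` (fst b \<inter> fst c). inj (frechet_derivative (transition b c) (at y))))"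

(* Components in the chart c of the ambient Levi-Civita derivative D_{d_i} d_j of the coordinate
   fields of the chart b of the submanifold. *)
definition ambient_derivative ::
  "('p, 'n::finite) metric_field \<Rightarrow> ('p, 'k::finite) chart \<Rightarrow> ('p, 'n) chart \<Rightarrow>
   'k \<Rightarrow> 'k \<Rightarrow> real^'k \<Rightarrow> real^'n" where
  "ambient_derivative g b c i j y =
     (let f = transition b c in
        (\<chi> l. partial i (partial j f) y $ l +
           (\<Sum>m\<in>UNIV. \<Sum>n\<in>UNIV. christoffel g c l m n (f y) * partial i f y $ m * partial j f y $ n)))"

definition normal_vector ::
  "('p, 'n::finite) metric_field \<Rightarrow> ('p, 'k::finite) chart \<Rightarrow> ('p, 'n) chart \<Rightarrow>
   real^'k \<Rightarrow> real^'n \<Rightarrow> bool" where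
  "normal_vector g b c y \<nu> \<longleftrightarrow>
     (\<forall>i. g c (transition b c y) (partial i (transition b c) y) \<nu> = 0)"

definition second_fundamental_form ::
  "('p, 'n::finite) metric_field \<Rightarrow> ('p, 'k::finite) chart \<Rightarrow> ('p, 'n) chart \<Rightarrow>
   real^'k \<Rightarrow> real^'n \<Rightarrow> 'k \<Rightarrow> 'k \<Rightarrow> real" where
  "second_fundamental_form g b c y \<nu> i j = g c (transition b c y) (ambient_derivative g b c i j y) \<nu>"

(* The second fundamental form with respect to every normal vector vanishes. *)
definition totally_geodesic ::
  "('p, 'n::finite) chart set \<Rightarrow> ('p, 'n) metric_field \<Rightarrow> ('p, 'k::finite) chart set \<Rightarrow> bool" where
  "totally_geodesic A g B \<longleftrightarrow>
     (\<forall>b\<in>B. \<forall>c\<in>A. \<forall>y \<in> snd b ` (fst b \<inter> fst c). \<forall>\<nu>. normal_vector g b c y \<nu> \<longrightarrow>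
        (\<forall>i j. second_fundamental_form g b c y \<nu> i j = 0))"

end

theory Submission
  imports Defs
begin

text \<open>Let N be a totally geodesic hypersurface of the tangent bundle TM of a surface M with its Sasaki
metric. Along N write \<xi> for the fibre point, X and Z for the horizontal and vertical parts of
tangent vectors, D for the covariant derivative of M along the base point, and let n be a unit
normal field with horizontal part p and vertical part q. A unit normal field of a totally geodesic
hypersurface is parallel. Splitting this into horizontal and vertical parts (lemmas
\<open>gauss_formula\<close>, \<open>normal_derivative\<close>) gives, for every tangent direction E and every vector u,

  D_E q = R(X_E, p) \<xi> / 2,

  <u, D_E p> = - <R(X_E, u) \<xi>, q> / 2 + <Z_E, R(u, p) \<xi>> / 2.

On a surface R(u, v) w = area(u, v) \<R> w with \<R> skew, and \<R> is injective where the curvature does not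
vanish. The equations then leave no room for n.

Suppose q is nonzero at some point, hence on an open set. Then N meets the fibres in curves, and X takes
all values. Along the direction of such a curve, with tangent vector \<zeta> orthogonal to q, q is constant, and
comparing mixed second derivatives of q in this and an arbitrary direction shows that p = 0 or that
\<xi> is orthogonal to q (\<open>horizontal_normal_or_orthogonal_fibre\<close>). If p were nonzero, the second
alternative would hold on an open set, and differentiating it makes all Z orthogonal to q, hence all
X orthogonal to p, which contradicts that X takes all values (\<open>horizontal_normal_zero\<close>).
So p = 0, whence q is parallel, so R(u, v) q = 0 for all u and v and q = 0 after all
(\<open>vertical_normal_zero\<close>).

So q = 0 everywhere and p is nonzero. Now the first equation gives area(X, p) \<R> \<xi> = 0, so \<xi> = 0
and N would lie in the zero section, which has dimension two (\<open>no_parameters\<close>).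

All equations are local, so everything takes place in one chart of M around the foot point of a point of N,
shrunk so that the curvature computed in that chart does not vanish.
The Levi-Civita connection of the Sasaki metric enters only with its index lowered
(\<open>sasaki_christoffel\<close>). The normal field is constructed as a differentiable field; that q has second
derivatives follows from the first equation, whose right-hand side is differentiable again.\<close>

section \<open>Calculus of C^k functions\<close>

lemma C_k_on_cong:
  assumes "open S" "\<And>x. x \<in> S \<Longrightarrow> f x = g x" "C_k_on k S f"
  shows "C_k_on k S g"
  using assms(2,3)
proof (induction k arbitrary: f g)
  case 0
  then show ?case using continuous_on_cong[of S S f g] by simp
next
  case (Suc k)
  have df: "f differentiable (at x)" if "x \<in> S" for x using Suc.prems that by simp
  have dg: "(g has_derivative frechet_derivative f (at x)) (at x)" if "x \<in> S" for x
    using df[OF that] Suc.prems(1) that assms(1)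
    by (meson frechet_derivative_works has_derivative_transform_within_open)
  have eq: "frechet_derivative f (at x) = frechet_derivative g (at x)" if "x \<in> S" for x
    using dg[OF that] by (rule frechet_derivative_at)
  show ?case
    using Suc.prems(2) eq dg
    by (auto intro: differentiableI Suc.IH[of "\<lambda>x. frechet_derivative f (at x) v" for v])
qed

lemma C_k_on_Suc_D: "C_k_on (Suc k) S f \<Longrightarrow> C_k_on k S f"
proof (induction k arbitrary: f)
  case 0
  then show ?case
    by (auto intro!: differentiable_imp_continuous_on differentiable_at_imp_differentiable_on)
next
  case (Suc k)
  show ?case
    unfolding C_k_on.simps(2)[of k S f]
    using Suc.prems Suc.IH unfolding C_k_on.simps(2)[of "Suc k" S f] by blast
qed

lemma C_k_on_SucI:
  assumes "open S" and "\<And>x. x \<in> S \<Longrightarrow> (f has_derivative f' x) (at x)"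
    and "\<And>v. C_k_on k S (\<lambda>x. f' x v)"
  shows "C_k_on (Suc k) S f"
proof -
  have "f' x = frechet_derivative f (at x)" if "x \<in> S" for x
    using assms(2)[OF that] by (rule frechet_derivative_at)
  then have "C_k_on k S (\<lambda>x. frechet_derivative f (at x) v)" for v
    by (intro C_k_on_cong[OF assms(1) _ assms(3)[of v]]) auto
  then show ?thesis
    using assms(2) by (auto intro: differentiableI)
qed

lemma C_k_on_SucD_derivative:
  assumes "C_k_on (Suc k) S f" "x \<in> S"
  shows "(f has_derivative frechet_derivative f (at x)) (at x)"
  using assms frechet_derivative_works by auto

lemma C_k_on_const: "open S \<Longrightarrow> C_k_on k S (\<lambda>x. a)"
proof (induction k arbitrary: a)
  case (Suc k)
  show ?case
    by (rule C_k_on_SucI[OF Suc.prems, of _ "\<lambda>x v. 0"]) (use Suc in auto)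
qed auto

lemma C_k_on_bounded_linear:
  assumes "open S" "bounded_linear h" "C_k_on k S f"
  shows "C_k_on k S (\<lambda>x. h (f x))"
  using assms(3)
proof (induction k arbitrary: f)
  case 0
  then show ?case
    using assms(2) by (simp add: bounded_linear.continuous_on)
next
  case (Suc k)
  show ?case
    by (rule C_k_on_SucI[OF assms(1), of _ "\<lambda>x v. h (frechet_derivative f (at x) v)"])
      (use Suc C_k_on_SucD_derivative[OF Suc.prems] in
        \<open>auto intro: bounded_linear.has_derivative[OF assms(2)]\<close>)
qed

lemma C_k_on_add:
  assumes "open S" "C_k_on k S f" "C_k_on k S g"
  shows "C_k_on k S (\<lambda>x. f x + g x)"
  using assms(2,3)
proof (induction k arbitrary: f g)
  case (Suc k)
  show ?case
    by (rule C_k_on_SucI[OF assms(1), of _ "\<lambda>x v. frechet_derivative f (at x) v + frechet_derivative g (at x) v"])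
      (use Suc C_k_on_SucD_derivative[OF Suc.prems(1)] C_k_on_SucD_derivative[OF Suc.prems(2)]
        has_derivative_add in auto)
qed (auto intro: continuous_intros)

lemma C_k_on_mult:
  fixes f g :: "'a::euclidean_space \<Rightarrow> real"
  assumes "open S" "C_k_on k S f" "C_k_on k S g"
  shows "C_k_on k S (\<lambda>x. f x * g x)"
  using assms(2,3)
proof (induction k arbitrary: f g)
  case (Suc k)
  show ?case
  proof (rule C_k_on_SucI[OF assms(1), of _ "\<lambda>x v. f x * frechet_derivative g (at x) v + frechet_derivative f (at x) v * g x"])
    show "((\<lambda>x. f x * g x) has_derivative (\<lambda>v. f x * frechet_derivative g (at x) v + frechet_derivative f (at x) v * g x)) (at x)"
      if "x \<in> S" for x
      using C_k_on_SucD_derivative[OF Suc.prems(1) that] C_k_on_SucD_derivative[OF Suc.prems(2) that]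
      by (rule has_derivative_mult)
    show "C_k_on k S (\<lambda>x. f x * frechet_derivative g (at x) v + frechet_derivative f (at x) v * g x)" for v
      using Suc.prems C_k_on_Suc_D[OF Suc.prems(1)] C_k_on_Suc_D[OF Suc.prems(2)]
      by (intro C_k_on_add assms(1) Suc.IH) auto
  qed
qed (auto intro: continuous_intros)

lemma C_k_on_inverse:
  fixes f :: "'a::euclidean_space \<Rightarrow> real"
  assumes "open S" "\<And>x. x \<in> S \<Longrightarrow> f x \<noteq> 0" "C_k_on k S f"
  shows "C_k_on k S (\<lambda>x. inverse (f x))"
  using assms(3)
proof (induction k)
  case (Suc k)
  show ?case
  proof (rule C_k_on_SucI[OF assms(1), of _ "\<lambda>x v. (-1) * ((inverse (f x) * frechet_derivative f (at x) v) * inverse (f x))"])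
    show "((\<lambda>x. inverse (f x)) has_derivative (\<lambda>v. (-1) * ((inverse (f x) * frechet_derivative f (at x) v) * inverse (f x)))) (at x)"
      if "x \<in> S" for x
      using Deriv.has_derivative_inverse[OF assms(2)[OF that] C_k_on_SucD_derivative[OF Suc.prems(1) that]]
      by simp
    show "C_k_on k S (\<lambda>x. (-1) * ((inverse (f x) * frechet_derivative f (at x) v) * inverse (f x)))" for v
      using Suc C_k_on_Suc_D[OF Suc.prems(1)]
      by (intro C_k_on_mult C_k_on_const assms(1)) auto
  qed
qed (use assms(2) in \<open>auto intro!: continuous_intros\<close>)

lemma C_k_on_sum:
  assumes "open S" "\<And>i. i \<in> I \<Longrightarrow> C_k_on k S (f i)"
  shows "C_k_on k S (\<lambda>x. \<Sum>i\<in>I. f i x)"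
  using assms(2)
  by (induction I rule: infinite_finite_induct) (auto intro: C_k_on_const C_k_on_add assms(1))

lemma C_k_on_prod:
  fixes f :: "'i \<Rightarrow> 'a::euclidean_space \<Rightarrow> real"
  assumes "open S" "\<And>i. i \<in> I \<Longrightarrow> C_k_on k S (f i)"
  shows "C_k_on k S (\<lambda>x. \<Prod>i\<in>I. f i x)"
  using assms(2)
  by (induction I rule: infinite_finite_induct) (auto intro: C_k_on_const C_k_on_mult assms(1))

lemma C_k_on_det:
  fixes A :: "'a::euclidean_space \<Rightarrow> real^'n^'n"
  assumes "open S" "\<And>i j. C_k_on k S (\<lambda>x. A x $ i $ j)"
  shows "C_k_on k S (\<lambda>x. det (A x))"
  unfolding det_def
  by (intro C_k_on_sum C_k_on_mult C_k_on_const C_k_on_prod assms)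

lemma matrix_mul_matrix_inv:
  fixes A :: "real^'n^'n"
  assumes "invertible A"
  shows "A ** matrix_inv A = mat 1"
proof -
  have "A ** matrix_inv A = mat 1 \<and> matrix_inv A ** A = mat 1"
    unfolding matrix_inv_def using assms unfolding invertible_def by (rule someI_ex)
  then show ?thesis by blast
qed

text \<open>Cramer's rule writes the entries of the inverse as quotients of determinants, so that the inverse of a
matrix-valued function inherits its regularity from sums, products and reciprocals.\<close>

lemma matrix_inv_entry_cramer:
  fixes A :: "real^'n^'n"
  assumes "invertible A"
  shows "matrix_inv A $ k $ l = det (\<chi> i j. if j = k then axis l 1 $ i else A $ i $ j) * inverse (det A)"
proof -
  have "det A \<noteq> 0" using assms by (simp add: invertible_det_nz)
  moreover have "A *v (matrix_inv A *v axis l 1) = axis l 1"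
    using matrix_mul_matrix_inv[OF assms] by (simp add: matrix_vector_mul_assoc)
  ultimately have "matrix_inv A *v axis l 1 = (\<chi> k. det (\<chi> i j. if j = k then axis l 1 $ i else A $ i $ j) / det A)"
    using cramer by blast
  then show ?thesis
    by (simp add: matrix_vector_mul_component inner_axis vec_eq_iff field_simps)
qed

lemma C_k_on_matrix_inv:
  fixes A :: "'a::euclidean_space \<Rightarrow> real^'n^'n"
  assumes "open S" "\<And>i j. C_k_on k S (\<lambda>x. A x $ i $ j)" "\<And>x. x \<in> S \<Longrightarrow> invertible (A x)"
  shows "C_k_on k S (\<lambda>x. matrix_inv (A x) $ a $ b)"
proof (rule C_k_on_cong[OF assms(1)])
  show "det (\<chi> i j. if j = a then axis b 1 $ i else A x $ i $ j) * inverse (det (A x))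
      = matrix_inv (A x) $ a $ b" if "x \<in> S" for x
    using matrix_inv_entry_cramer[OF assms(3)[OF that]] by simp
  have "C_k_on k S (\<lambda>x. (\<chi> i j. if j = a then axis b 1 $ i else A x $ i $ j) $ i $ j)" for i j
    using assms by (cases "j = a") (auto intro: C_k_on_const)
  then show "C_k_on k S (\<lambda>x. det (\<chi> i j. if j = a then axis b 1 $ i else A x $ i $ j) * inverse (det (A x)))"
    using assms by (intro C_k_on_mult C_k_on_inverse C_k_on_det) (auto simp: invertible_det_nz)
qed

section \<open>Symmetry of second derivatives\<close>

text \<open>The mean value theorem in the direction u turns the second difference into t times the increment of the
directional derivative along t v, and differentiability of that directional derivative at a evaluates this
increment up to o(t). The second difference is symmetric in u and v, so that exchanging them computes the
same limit from the other directional derivative.\<close>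

lemma second_difference_quotient:
  fixes f :: "'a::euclidean_space \<Rightarrow> real"
  assumes "open S" "a \<in> S" and df: "\<And>x. x \<in> S \<Longrightarrow> f differentiable (at x)"
    and L: "((\<lambda>x. frechet_derivative f (at x) u) has_derivative L) (at a)"
  shows "((\<lambda>t. (f (a + t *\<^sub>R u + t *\<^sub>R v) - f (a + t *\<^sub>R u) - f (a + t *\<^sub>R v) + f a) / t\<^sup>2) \<longlongrightarrow> L v) (at_right 0)"
proof (rule tendstoI)
  fix e :: real assume "e > 0"
  define K where "K = 2 * (norm u + norm v) + 1"
  have K: "K > 0" by (simp add: K_def add_nonneg_pos)
  define e' where "e' = e / (2 * K)"
  have e': "e' > 0" using \<open>e > 0\<close> K by (simp add: e'_def)
  let ?D = "\<lambda>x. frechet_derivative f (at x) u"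
  interpret L: bounded_linear L using L by (rule has_derivative_bounded_linear)
  obtain d1 where d1: "d1 > 0" "\<And>x. norm (x - a) < d1 \<Longrightarrow> norm (?D x - ?D a - L (x - a)) \<le> e' * norm (x - a)"
    using L e' unfolding has_derivative_at_alt by meson
  obtain d2 where d2: "d2 > 0" "ball a d2 \<subseteq> S" using assms(1,2) open_contains_ball by blast
  define d where "d = min d1 d2 / K"
  have "d > 0" using d1 d2 K by (simp add: d_def)
  have close: "norm (s *\<^sub>R u + r *\<^sub>R v) \<le> t * (norm u + norm v)" if "\<bar>s\<bar> \<le> t" "\<bar>r\<bar> \<le> t" for s r t
    using norm_triangle_ineq[of "s *\<^sub>R u" "r *\<^sub>R v"] mult_right_mono[OF that(1), of "norm u"] mult_right_mono[OF that(2), of "norm v"]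
    by (simp add: distrib_left)
  have main: "dist ((f (a + t *\<^sub>R u + t *\<^sub>R v) - f (a + t *\<^sub>R u) - f (a + t *\<^sub>R v) + f a) / t\<^sup>2) (L v) < e"
    if t: "0 < t" "t < d" for t
  proof -
    have tK: "t * K < min d1 d2" using t K by (simp add: d_def pos_less_divide_eq)
    have tK': "t * (norm u + norm v) < min d1 d2"
    proof -
      have "t * (norm u + norm v) \<le> t * K" using t by (intro mult_left_mono) (auto simp: K_def)
      then show ?thesis using tK by linarith
    qed
    have inS: "a + s *\<^sub>R u + r *\<^sub>R v \<in> S" if "0 \<le> s" "s \<le> t" "0 \<le> r" "r \<le> t" for s r
    proof -
      have "norm (s *\<^sub>R u + r *\<^sub>R v) < d2" using close[of s t r] that tK' by auto
      moreover have "dist a (a + s *\<^sub>R u + r *\<^sub>R v) = norm (s *\<^sub>R u + r *\<^sub>R v)"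
        by (metis add.assoc add_diff_cancel_left' dist_commute dist_norm)
      ultimately show ?thesis using d2(2) by (auto simp: subset_iff)
    qed
    define \<phi> where "\<phi> = (\<lambda>s. f (a + s *\<^sub>R u + t *\<^sub>R v) - f (a + s *\<^sub>R u))"
    have der: "(\<phi> has_real_derivative (?D (a + s *\<^sub>R u + t *\<^sub>R v) - ?D (a + s *\<^sub>R u))) (at s)"
      if s: "0 \<le> s" "s \<le> t" for s
    proof -
      have *: "((\<lambda>s. f (a + s *\<^sub>R u + w)) has_real_derivative ?D (a + s *\<^sub>R u + w)) (at s)"
        if "a + s *\<^sub>R u + w \<in> S" for w
      proof -
        have 1: "((\<lambda>s. a + s *\<^sub>R u + w) has_derivative (\<lambda>h. h *\<^sub>R u)) (at s)"
          by (auto intro!: derivative_eq_intros)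
        have 2: "(f has_derivative frechet_derivative f (at (a + s *\<^sub>R u + w))) (at (a + s *\<^sub>R u + w))"
          using df[OF that] frechet_derivative_works by blast
        have "((\<lambda>s. f (a + s *\<^sub>R u + w)) has_derivative (\<lambda>h. frechet_derivative f (at (a + s *\<^sub>R u + w)) (h *\<^sub>R u))) (at s)"
          using diff_chain_at[OF 1 2] by (simp add: o_def)
        moreover have "frechet_derivative f (at (a + s *\<^sub>R u + w)) (h *\<^sub>R u) = h * ?D (a + s *\<^sub>R u + w)" for h
          using linear_frechet_derivative[OF df[OF that]] by (simp add: linear_cmul)
        ultimately show ?thesis by (simp add: has_field_derivative_def mult.commute[of _ "?D _"])
      qed
      show ?thesis unfolding \<phi>_def
        using *[of "t *\<^sub>R v"] *[of 0] inS[OF s, of t] inS[OF s, of 0] t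
        by (auto intro!: DERIV_diff)
    qed
    obtain \<sigma> where \<sigma>: "0 < \<sigma>" "\<sigma> < t" "\<phi> t - \<phi> 0 = (t - 0) * (?D (a + \<sigma> *\<^sub>R u + t *\<^sub>R v) - ?D (a + \<sigma> *\<^sub>R u))"
      using MVT2[OF t(1), of \<phi> "\<lambda>s. ?D (a + s *\<^sub>R u + t *\<^sub>R v) - ?D (a + s *\<^sub>R u)"] der by blast
    let ?p = "a + \<sigma> *\<^sub>R u + t *\<^sub>R v" and ?q = "a + \<sigma> *\<^sub>R u"
    have np: "norm (?p - a) \<le> t * (norm u + norm v)" 
      using close[of \<sigma> t t] \<sigma> by (simp add: add.assoc)
    have nq: "norm (?q - a) \<le> t * (norm u + norm v)"
      using close[of \<sigma> t 0] \<sigma> by (simp add: add.assoc)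
    have bp: "norm (?D ?p - ?D a - L (?p - a)) \<le> e' * (t * (norm u + norm v))"
      by (rule order_trans[OF d1(2)]) (use np tK' e' in auto)
    have bq: "norm (?D ?q - ?D a - L (?q - a)) \<le> e' * (t * (norm u + norm v))"
      by (rule order_trans[OF d1(2)]) (use nq tK' e' in auto)
    have Lpq: "L (?p - a) - L (?q - a) = t * L v"
      by (simp add: L.add L.diff L.scaleR)
    have "\<bar>(?D ?p - ?D ?q) - t * L v\<bar> \<le> 2 * (e' * (t * (norm u + norm v)))"
      using bp bq Lpq unfolding real_norm_def by linarith
    also have "\<dots> = e' * t * (2 * (norm u + norm v))" by simp
    also have "\<dots> < e' * t * K"
      using e' t by (intro mult_strict_left_mono) (auto simp: K_def)
    also have "\<dots> = t * (e / 2)" using K by (simp add: e'_def)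
    finally have b: "\<bar>(?D ?p - ?D ?q) - t * L v\<bar> < t * (e / 2)" .
    have "(f (a + t *\<^sub>R u + t *\<^sub>R v) - f (a + t *\<^sub>R u) - f (a + t *\<^sub>R v) + f a) / t\<^sup>2 - L v
        = ((?D ?p - ?D ?q) - t * L v) / t"
    proof -
      have "f (a + t *\<^sub>R u + t *\<^sub>R v) - f (a + t *\<^sub>R u) - f (a + t *\<^sub>R v) + f a = t * (?D ?p - ?D ?q)"
        using \<sigma>(3) by (simp add: \<phi>_def)
      then show ?thesis
        using t by (simp add: diff_divide_distrib power2_eq_square)
    qed
    then have "dist ((f (a + t *\<^sub>R u + t *\<^sub>R v) - f (a + t *\<^sub>R u) - f (a + t *\<^sub>R v) + f a) / t\<^sup>2) (L v)
        = \<bar>(?D ?p - ?D ?q) - t * L v\<bar> / t"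
      using t by (simp add: dist_real_def)
    also have "\<dots> < e"
      using b t mult_pos_pos[OF t(1) \<open>e > 0\<close>] by (simp add: pos_divide_less_eq mult.commute)
    finally show ?thesis .
  qed
  show "\<forall>\<^sub>F t in at_right 0. dist ((f (a + t *\<^sub>R u + t *\<^sub>R v) - f (a + t *\<^sub>R u) - f (a + t *\<^sub>R v) + f a) / t\<^sup>2) (L v) < e"
    unfolding eventually_at_right_field using \<open>d > 0\<close> main by (intro exI[of _ d]) auto
qed

lemma second_derivative_symmetric_real:
  fixes f :: "'a::euclidean_space \<Rightarrow> real"
  assumes "open S" "a \<in> S" "\<And>x. x \<in> S \<Longrightarrow> f differentiable (at x)"
    and "((\<lambda>x. frechet_derivative f (at x) u) has_derivative L) (at a)"
    and "((\<lambda>x. frechet_derivative f (at x) v) has_derivative L') (at a)"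
  shows "L v = L' u"
proof -
  have "((\<lambda>t. (f (a + t *\<^sub>R u + t *\<^sub>R v) - f (a + t *\<^sub>R u) - f (a + t *\<^sub>R v) + f a) / t\<^sup>2) \<longlongrightarrow> L v) (at_right 0)"
    using assms by (intro second_difference_quotient) auto
  moreover have "((\<lambda>t. (f (a + t *\<^sub>R v + t *\<^sub>R u) - f (a + t *\<^sub>R v) - f (a + t *\<^sub>R u) + f a) / t\<^sup>2) \<longlongrightarrow> L' u) (at_right 0)"
    using assms by (intro second_difference_quotient) auto
  then have "((\<lambda>t. (f (a + t *\<^sub>R u + t *\<^sub>R v) - f (a + t *\<^sub>R u) - f (a + t *\<^sub>R v) + f a) / t\<^sup>2) \<longlongrightarrow> L' u) (at_right 0)"
    by (simp add: algebra_simps)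
  ultimately show ?thesis
    using tendsto_unique trivial_limit_at_right_real by blast
qed

text \<open>Stated for two directional derivatives that are differentiable at a, because this is what is known of the
normal field of a hypersurface: its first derivative is an explicit expression in differentiable
quantities.\<close>

lemma second_derivative_symmetric:
  fixes f :: "'a::euclidean_space \<Rightarrow> 'b::euclidean_space"
  assumes "open S" "a \<in> S" and f: "\<And>x. x \<in> S \<Longrightarrow> (f has_derivative f' x) (at x)"
    and u: "((\<lambda>x. f' x u) has_derivative L) (at a)"
    and v: "((\<lambda>x. f' x v) has_derivative L') (at a)"
  shows "L v = L' u"
proof (rule euclidean_eqI)
  fix b :: 'b assume "b \<in> Basis"
  have d: "((\<lambda>x. f x \<bullet> b) has_derivative (\<lambda>h. f' x h \<bullet> b)) (at x)" if "x \<in> S" for x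
    using f[OF that] by (rule has_derivative_inner_left)
  have eq: "frechet_derivative (\<lambda>x. f x \<bullet> b) (at x) h = f' x h \<bullet> b" if "x \<in> S" for x h
    using frechet_derivative_at[OF d[OF that]] by metis
  show "L v \<bullet> b = L' u \<bullet> b"
  proof (rule second_derivative_symmetric_real[OF assms(1,2)])
    show "(\<lambda>x. f x \<bullet> b) differentiable (at x)" if "x \<in> S" for x
      using d[OF that] by (rule differentiableI)
    show "((\<lambda>x. frechet_derivative (\<lambda>x. f x \<bullet> b) (at x) u) has_derivative (\<lambda>h. L h \<bullet> b)) (at a)"
      by (rule has_derivative_transform_within_open[OF has_derivative_inner_left[OF u] assms(1,2)])
        (simp add: eq)
    show "((\<lambda>x. frechet_derivative (\<lambda>x. f x \<bullet> b) (at x) v) has_derivative (\<lambda>h. L' h \<bullet> b)) (at a)"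
      by (rule has_derivative_transform_within_open[OF has_derivative_inner_left[OF v] assms(1,2)])
        (simp add: eq)
  qed
qed

section \<open>Fields of bilinear maps\<close>

lemma linear_axis_expansion:
  fixes f :: "real^'n \<Rightarrow> 'b::real_vector"
  assumes "linear f"
  shows "f u = (\<Sum>i\<in>UNIV. u $ i *\<^sub>R f (axis i 1))"
proof -
  have "f u = f (\<Sum>i\<in>UNIV. u $ i *\<^sub>R axis i 1)"
    using basis_expansion[of u] by (simp add: scalar_mult_eq_scaleR)
  also have "\<dots> = (\<Sum>i\<in>UNIV. u $ i *\<^sub>R f (axis i 1))"
    by (simp add: linear_sum[OF assms] linear_cmul[OF assms])
  finally show ?thesis .
qed

lemma bilinear_axis_expansion:
  fixes B :: "real^'n \<Rightarrow> real^'m \<Rightarrow> 'b::real_vector"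
  assumes "bilinear B"
  shows "B u w = (\<Sum>i\<in>UNIV. \<Sum>j\<in>UNIV. (u $ i * w $ j) *\<^sub>R B (axis i 1) (axis j 1))"
proof -
  have "B u w = (\<Sum>i\<in>UNIV. u $ i *\<^sub>R B (axis i 1) w)"
    using assms by (intro linear_axis_expansion[of "\<lambda>u. B u w"]) (simp add: bilinear_def)
  moreover have "B v w = (\<Sum>j\<in>UNIV. w $ j *\<^sub>R B v (axis j 1))" for v
    using assms by (intro linear_axis_expansion) (simp add: bilinear_def)
  ultimately show ?thesis by (simp add: scaleR_sum_right)
qed

lemmas bilinear_expand =
  bilinear_ladd bilinear_radd bilinear_lsub bilinear_rsub bilinear_lmul bilinear_rmul
  bilinear_lneg bilinear_rneg bilinear_lzero bilinear_rzero

text \<open>Metrics, connections and curvature tensors in a chart are all maps from points to bilinear maps. The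
derivative with respect to the base point is taken with the two vector arguments held fixed; it is
again bilinear in them.\<close>

definition field_derivative ::
  "('a::real_normed_vector \<Rightarrow> 'u \<Rightarrow> 'v \<Rightarrow> 'b::real_normed_vector) \<Rightarrow> 'a \<Rightarrow> 'a \<Rightarrow> 'u \<Rightarrow> 'v \<Rightarrow> 'b" where
  "field_derivative B x a u w = frechet_derivative (\<lambda>z. B z u w) (at x) a"

locale bilinear_field =
  fixes V :: "'a::euclidean_space set" and B :: "'a \<Rightarrow> real^'n \<Rightarrow> real^'m \<Rightarrow> 'b::euclidean_space"
  assumes open_domain: "open V"
    and bilinear: "x \<in> V \<Longrightarrow> bilinear (B x)"
    and differentiable: "x \<in> V \<Longrightarrow> (\<lambda>x. B x u w) differentiable (at x)"
begin

lemma has_derivative_fixed: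
  "x \<in> V \<Longrightarrow> ((\<lambda>z. B z u w) has_derivative (\<lambda>a. field_derivative B x a u w)) (at x)"
  using differentiable frechet_derivative_works unfolding field_derivative_def by (metis eta_contract_eq)

lemma field_derivative_eqI:
  assumes "x \<in> V" "\<And>z. z \<in> V \<Longrightarrow> B z u w = h z" "(h has_derivative h') (at x)"
  shows "field_derivative B x a u w = h' a"
proof -
  have "((\<lambda>z. B z u w) has_derivative h') (at x)"
    by (rule has_derivative_transform_within_open[OF assms(3) open_domain assms(1)]) (simp add: assms(2))
  then show ?thesis
    unfolding field_derivative_def by (metis frechet_derivative_at)
qed

lemma linear_direction: "x \<in> V \<Longrightarrow> linear (\<lambda>a. field_derivative B x a u w)"
  using has_derivative_fixed has_derivative_linear by blast

lemma bilinear_field_derivative: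
  assumes x: "x \<in> V"
  shows "bilinear (field_derivative B x a)"
  unfolding bilinear_def
proof (intro conjI allI linearI)
  note d = has_derivative_fixed[OF x]
  show "field_derivative B x a u (w1 + w2) = field_derivative B x a u w1 + field_derivative B x a u w2" for u w1 w2
    by (rule field_derivative_eqI[OF x _ has_derivative_add[OF d d]])
      (simp add: bilinear_radd[OF bilinear])
  show "field_derivative B x a (u1 + u2) w = field_derivative B x a u1 w + field_derivative B x a u2 w" for w u1 u2
    by (rule field_derivative_eqI[OF x _ has_derivative_add[OF d d]])
      (simp add: bilinear_ladd[OF bilinear])
  show "field_derivative B x a u (r *\<^sub>R w) = r *\<^sub>R field_derivative B x a u w" for u w r
    by (rule field_derivative_eqI[OF x _ has_derivative_scaleR_right[OF d]])
      (simp add: bilinear_rmul[OF bilinear])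
  show "field_derivative B x a (r *\<^sub>R u) w = r *\<^sub>R field_derivative B x a u w" for u w r
    by (rule field_derivative_eqI[OF x _ has_derivative_scaleR_right[OF d]])
      (simp add: bilinear_lmul[OF bilinear])
qed

lemmas expand = bilinear_expand[OF bilinear] bilinear_expand[OF bilinear_field_derivative]
  linear_add[OF linear_direction] linear_diff[OF linear_direction] linear_cmul[OF linear_direction]
  linear_neg[OF linear_direction] linear_0[OF linear_direction]

lemma has_derivative:
  fixes p :: "'t::real_normed_vector \<Rightarrow> 'a"
  assumes V: "p t \<in> V" and p: "(p has_derivative p') (at t)"
    and u: "(u has_derivative u') (at t)" and w: "(w has_derivative w') (at t)"
  shows "((\<lambda>s. B (p s) (u s) (w s)) has_derivative
    (\<lambda>h. field_derivative B (p t) (p' h) (u t) (w t) + B (p t) (u' h) (w t) + B (p t) (u t) (w' h))) (at t)"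
proof -
  let ?e = "\<lambda>i. axis i (1::real)"
  have comp: "((\<lambda>s. B (p s) (?e i) (?e j)) has_derivative (\<lambda>h. field_derivative B (p t) (p' h) (?e i) (?e j))) (at t)" for i j
    using diff_chain_at[OF p has_derivative_fixed[OF V]] by (simp add: o_def)
  have uc: "((\<lambda>s. u s $ i) has_derivative (\<lambda>h. u' h $ i)) (at t)" for i
    by (rule bounded_linear.has_derivative[OF bounded_linear_vec_nth u])
  have wc: "((\<lambda>s. w s $ i) has_derivative (\<lambda>h. w' h $ i)) (at t)" for i
    by (rule bounded_linear.has_derivative[OF bounded_linear_vec_nth w])
  have 1: "((\<lambda>s. \<Sum>i\<in>UNIV. \<Sum>j\<in>UNIV. (u s $ i * w s $ j) *\<^sub>R B (p s) (?e i) (?e j)) has_derivative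
    (\<lambda>h. \<Sum>i\<in>UNIV. \<Sum>j\<in>UNIV. (u t $ i * w t $ j) *\<^sub>R field_derivative B (p t) (p' h) (?e i) (?e j)
       + (u t $ i * w' h $ j + u' h $ i * w t $ j) *\<^sub>R B (p t) (?e i) (?e j))) (at t)"
    by (intro has_derivative_sum has_derivative_scaleR has_derivative_mult comp uc wc)
  have ev: "\<forall>\<^sub>F s in at t. p s \<in> V"
  proof -
    have "(p \<longlongrightarrow> p t) (at t)" using has_derivative_continuous[OF p] by (simp add: continuous_within)
    then show ?thesis using open_domain V by (rule topological_tendstoD)
  qed
  have 2: "((\<lambda>s. B (p s) (u s) (w s)) has_derivative
    (\<lambda>h. \<Sum>i\<in>UNIV. \<Sum>j\<in>UNIV. (u t $ i * w t $ j) *\<^sub>R field_derivative B (p t) (p' h) (?e i) (?e j)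
       + (u t $ i * w' h $ j + u' h $ i * w t $ j) *\<^sub>R B (p t) (?e i) (?e j))) (at t)"
    by (rule has_derivative_transform_eventually[OF 1])
      (use V ev in \<open>auto elim!: eventually_mono simp: bilinear_axis_expansion[OF bilinear]\<close>)
  have "field_derivative B (p t) (p' h) (u t) (w t) + B (p t) (u' h) (w t) + B (p t) (u t) (w' h)
    = (\<Sum>i\<in>UNIV. \<Sum>j\<in>UNIV. (u t $ i * w t $ j) *\<^sub>R field_derivative B (p t) (p' h) (?e i) (?e j)
       + (u t $ i * w' h $ j + u' h $ i * w t $ j) *\<^sub>R B (p t) (?e i) (?e j))" for h
    unfolding bilinear_axis_expansion[OF bilinear_field_derivative[OF V], of "p' h" "u t" "w t"]
      bilinear_axis_expansion[OF bilinear[OF V], of "u' h" "w t"]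
      bilinear_axis_expansion[OF bilinear[OF V], of "u t" "w' h"]
    by (simp add: sum.distrib scaleR_add_left algebra_simps)
  then show ?thesis using 2 by presburger
qed

end

section \<open>The Levi-Civita connection in a chart\<close>

text \<open>The bilinear map whose components are the Christoffel symbols; it lets the connection be treated without
indices.\<close>

definition christoffel_map ::
  "('p, 'n::finite) metric_field \<Rightarrow> ('p, 'n) chart \<Rightarrow> real^'n \<Rightarrow> real^'n \<Rightarrow> real^'n \<Rightarrow> real^'n" where
  "christoffel_map g c x u v =
     (\<chi> l. \<Sum>m\<in>UNIV. \<Sum>n\<in>UNIV. christoffel g c l m n x * u $ m * v $ n)"

lemma bilinear_christoffel_map: "bilinear (christoffel_map g c x)"
  unfolding bilinear_def christoffel_map_def
  by (intro conjI allI linearI)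
    (simp_all add: vec_eq_iff algebra_simps sum.distrib sum_distrib_left)

locale metric_on_chart = bilinear_field V "g c"
  for g :: "('p, 'n::finite) metric_field" and c :: "('p, 'n) chart" and V :: "(real^'n) set" +
  assumes symmetric: "x \<in> V \<Longrightarrow> g c x u w = g c x w u"
    and positive: "x \<in> V \<Longrightarrow> u \<noteq> 0 \<Longrightarrow> g c x u u > 0"
begin

lemma field_derivative_symmetric:
  assumes "x \<in> V"
  shows "field_derivative (g c) x a u w = field_derivative (g c) x a w u"
  by (rule field_derivative_eqI[OF assms _ has_derivative_fixed[OF assms]]) (rule symmetric)

lemma nondegenerate:
  assumes "x \<in> V" "\<And>w. g c x u w = 0"
  shows "u = 0"
  using positive[of x u] assms by force

lemma nondegenerate_eq:
  assumes "x \<in> V" "\<And>w. g c x u w = g c x v w"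
  shows "u = v"
proof -
  have "u - v = 0"
    by (rule nondegenerate[OF assms(1)]) (simp add: bilinear_lsub[OF bilinear[OF assms(1)]] assms(2))
  then show ?thesis by simp
qed

lemma metric_eq_inner_matrix:
  assumes "x \<in> V"
  shows "g c x u w = w \<bullet> ((\<chi> a b. metric_coeff g c a b x) *v u)"
proof -
  have "g c x u w = g c x w u" using symmetric assms by blast
  also have "\<dots> = (\<Sum>i\<in>UNIV. \<Sum>j\<in>UNIV. w $ i * u $ j * metric_coeff g c i j x)"
    using bilinear_axis_expansion[OF bilinear[OF assms], of w u] by (simp add: metric_coeff_def)
  finally show ?thesis
    by (simp add: inner_vec_def matrix_vector_mult_def sum_distrib_left mult_ac)
qed

lemma invertible_metric_matrix:
  assumes "x \<in> V"
  shows "invertible (\<chi> a b. metric_coeff g c a b x)"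
proof -
  have "u = 0" if "(\<chi> a b. metric_coeff g c a b x) *v u = 0" for u
    using metric_eq_inner_matrix[OF assms, of u] that by (intro nondegenerate[OF assms]) simp
  then show ?thesis
    unfolding invertible_left_inverse matrix_left_invertible_ker by blast
qed

text \<open>Lowering the index cancels the inverse matrix in the definition of the Christoffel symbols. The
identities satisfied by the Levi-Civita connections of the base metric and of the Sasaki metric are all
derived from this formula; together with nondegeneracy it determines the connection.\<close>

lemma christoffel_map_lower:
  assumes x: "x \<in> V"
  shows "g c x (christoffel_map g c x a b) \<nu> =
    (field_derivative (g c) x a b \<nu> + field_derivative (g c) x b a \<nu> - field_derivative (g c) x \<nu> a b) / 2"
    (is "_ = ?L \<nu>")
proof -
  let ?G = "\<chi> a b. metric_coeff g c a b x"
  let ?D = "field_derivative (g c) x"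
  let ?e = "\<lambda>i. axis i (1::real)"
  have bil1: "bilinear (\<lambda>a b. ?D a b w)" for w
    using linear_direction[OF x] bilinear_field_derivative[OF x] by (auto simp: bilinear_def)
  have linL: "linear ?L"
    by (rule linearI) (simp_all add: expand[OF x] algebra_simps add_divide_distrib diff_divide_distrib)
  have Le: "?L (?e k) = (\<Sum>m\<in>UNIV. \<Sum>n\<in>UNIV. (a $ m * b $ n) *
      (partial m (metric_coeff g c n k) x + partial n (metric_coeff g c m k) x - partial k (metric_coeff g c m n) x)) / 2" for k
  proof -
    have p: "?D (?e m) (?e n) (?e k) = partial m (metric_coeff g c n k) x" for m n k
      by (simp add: partial_def field_derivative_def metric_coeff_def[abs_def])
    have "?D a b (?e k) = (\<Sum>m\<in>UNIV. \<Sum>n\<in>UNIV. (a $ m * b $ n) * partial m (metric_coeff g c n k) x)"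
      using bilinear_axis_expansion[OF bil1, of a b] by (simp add: p)
    moreover have "?D b a (?e k) = (\<Sum>m\<in>UNIV. \<Sum>n\<in>UNIV. (a $ m * b $ n) * partial n (metric_coeff g c m k) x)"
      using bilinear_axis_expansion[OF bil1, of b a]
      by (subst sum.swap) (simp add: p mult.commute)
    moreover have "?D (?e k) a b = (\<Sum>m\<in>UNIV. \<Sum>n\<in>UNIV. (a $ m * b $ n) * partial k (metric_coeff g c m n) x)"
      using bilinear_axis_expansion[OF bilinear_field_derivative[OF x], of "?e k" a b] by (simp add: p)
    ultimately show ?thesis
      by (simp add: sum.distrib sum_subtractf distrib_left right_diff_distrib)
  qed
  have swap: "(\<Sum>m\<in>UNIV. \<Sum>n\<in>UNIV. \<Sum>k\<in>UNIV. F m n k) = (\<Sum>k\<in>UNIV. \<Sum>m\<in>UNIV. \<Sum>n\<in>UNIV. F m n k)"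
    for F :: "'n \<Rightarrow> 'n \<Rightarrow> 'n \<Rightarrow> real"
  proof -
    have "(\<Sum>m\<in>UNIV. \<Sum>n\<in>UNIV. \<Sum>k\<in>UNIV. F m n k) = (\<Sum>m\<in>UNIV. \<Sum>k\<in>UNIV. \<Sum>n\<in>UNIV. F m n k)"
      by (intro sum.cong refl sum.swap)
    also have "\<dots> = (\<Sum>k\<in>UNIV. \<Sum>m\<in>UNIV. \<Sum>n\<in>UNIV. F m n k)"
      by (rule sum.swap)
    finally show ?thesis .
  qed
  have "christoffel_map g c x a b = matrix_inv ?G *v (\<chi> k. ?L (?e k))"
  proof (rule vec_eq_iff[THEN iffD2], rule allI)
    fix l
    have "christoffel_map g c x a b $ l = (\<Sum>m\<in>UNIV. \<Sum>n\<in>UNIV. \<Sum>k\<in>UNIV. matrix_inv ?G $ l $ k * ((a $ m * b $ n) *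
      (partial m (metric_coeff g c n k) x + partial n (metric_coeff g c m k) x - partial k (metric_coeff g c m n) x)) / 2)"
      by (simp add: christoffel_map_def christoffel_def sum_distrib_left sum_distrib_right mult_ac
          cong: sum.cong)
    also have "\<dots> = (\<Sum>k\<in>UNIV. \<Sum>m\<in>UNIV. \<Sum>n\<in>UNIV. matrix_inv ?G $ l $ k * ((a $ m * b $ n) *
      (partial m (metric_coeff g c n k) x + partial n (metric_coeff g c m k) x - partial k (metric_coeff g c m n) x)) / 2)"
      by (rule swap)
    also have "\<dots> = (matrix_inv ?G *v (\<chi> k. ?L (?e k))) $ l"
      by (simp only: Le matrix_vector_mult_def vec_lambda_beta sum_distrib_left sum_divide_distrib times_divide_eq_right)
    finally show "christoffel_map g c x a b $ l = (matrix_inv ?G *v (\<chi> k. ?L (?e k))) $ l" .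
  qed
  then have "?G *v christoffel_map g c x a b = (\<chi> k. ?L (?e k))"
    using matrix_mul_matrix_inv[OF invertible_metric_matrix[OF x]]
    by (simp add: matrix_vector_mul_assoc)
  then have "g c x (christoffel_map g c x a b) \<nu> = \<nu> \<bullet> (\<chi> k. ?L (?e k))"
    by (simp add: metric_eq_inner_matrix[OF x])
  also have "\<dots> = ?L \<nu>"
    using linear_axis_expansion[OF linL, of \<nu>] by (simp add: inner_vec_def)
  finally show ?thesis .
qed

lemma christoffel_map_symmetric:
  assumes "x \<in> V"
  shows "christoffel_map g c x a b = christoffel_map g c x b a"
  by (rule nondegenerate_eq[OF assms])
    (simp add: christoffel_map_lower[OF assms] field_derivative_symmetric[OF assms, of _ a b])

text \<open>Adding the lowered formulas for the pairs (a, u) and (a, w) cancels all derivatives except the one in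
the direction a.\<close>

lemma metric_compatible:
  assumes "x \<in> V"
  shows "field_derivative (g c) x a u w =
    g c x (christoffel_map g c x a u) w + g c x u (christoffel_map g c x a w)"
proof -
  have "g c x u (christoffel_map g c x a w) = g c x (christoffel_map g c x a w) u"
    using symmetric assms by blast
  moreover have "g c x (christoffel_map g c x a u) w + g c x (christoffel_map g c x a w) u
      = field_derivative (g c) x a u w"
    by (simp add: christoffel_map_lower[OF assms] field_derivative_symmetric[OF assms, of a w u]
        field_derivative_symmetric[OF assms, of w a u] field_derivative_symmetric[OF assms, of u a w]
        flip: add_divide_distrib)
  ultimately show ?thesis by metis
qed

end

section \<open>Smooth metrics and curvature\<close>

lemma C_k_on_imp_differentiable: "C_k_on (Suc k) S f \<Longrightarrow> x \<in> S \<Longrightarrow> f differentiable (at x)"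
  by simp

lemma C_k_on_of_axis_components:
  fixes f :: "'a::euclidean_space \<Rightarrow> real^'n"
  assumes "open S" "\<And>l. C_k_on k S (\<lambda>x. f x $ l)"
  shows "C_k_on k S f"
proof -
  have "C_k_on k S (\<lambda>x. \<Sum>l\<in>UNIV. f x $ l *\<^sub>R axis l (1::real))"
    by (intro C_k_on_sum assms(1) C_k_on_bounded_linear[OF assms(1) bounded_linear_scaleR_left assms(2)])
  moreover have "(\<Sum>l\<in>UNIV. f x $ l *\<^sub>R axis l (1::real)) = f x" for x
    using basis_expansion[of "f x"] by (simp add: scalar_mult_eq_scaleR)
  ultimately show ?thesis by simp
qed

locale smooth_metric_on_chart = metric_on_chart g c V
  for g :: "('p, 'n::finite) metric_field" and c :: "('p, 'n) chart" and V :: "(real^'n) set" +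
  assumes smooth: "smooth_on V (\<lambda>x. g c x u w)"
begin

abbreviation christoffel_on ("\<Gamma>") where "\<Gamma> \<equiv> christoffel_map g c"
abbreviation christoffel_derivative ("d\<Gamma>") where "d\<Gamma> \<equiv> field_derivative (christoffel_map g c)"

lemma C_k_on_metric: "C_k_on k V (\<lambda>x. g c x u w)"
  using smooth by (simp add: smooth_on_def)

lemma C_k_on_christoffel: "C_k_on k V (\<lambda>x. christoffel g c l m n x)"
proof -
  have m: "C_k_on k V (metric_coeff g c i j)" for i j k
    unfolding metric_coeff_def by (rule C_k_on_metric)
  have p: "C_k_on k V (\<lambda>x. partial h (metric_coeff g c i j) x)" for h i j
    using m[of "Suc k" i j] by (simp add: partial_def)
  have i: "C_k_on k V (\<lambda>x. matrix_inv (\<chi> a b. metric_coeff g c a b x) $ i $ j)" for i j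
    by (intro C_k_on_matrix_inv open_domain invertible_metric_matrix) (simp_all add: m)
  show ?thesis
    unfolding christoffel_def diff_conv_add_uminus
    using C_k_on_bounded_linear[OF open_domain bounded_linear_minus[OF bounded_linear_ident] p]
    by (intro C_k_on_mult C_k_on_const C_k_on_sum C_k_on_add open_domain i p)
qed

lemma C_k_on_christoffel_map: "C_k_on k V (\<lambda>x. \<Gamma> x u v)"
  unfolding christoffel_map_def
  by (rule C_k_on_of_axis_components[OF open_domain], simp)
    (intro C_k_on_sum C_k_on_mult C_k_on_const C_k_on_christoffel open_domain)

sublocale christoffel: bilinear_field V \<Gamma>
  using C_k_on_christoffel_map[of "Suc 0"]
  by unfold_locales (auto intro: open_domain bilinear_christoffel_map C_k_on_imp_differentiable)

lemma C_k_on_christoffel_derivative: "C_k_on k V (\<lambda>x. d\<Gamma> x a u v)"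
  using C_k_on_christoffel_map[of "Suc k"] by (simp add: field_derivative_def)

definition curvature :: "real^'n \<Rightarrow> real^'n \<Rightarrow> real^'n \<Rightarrow> real^'n \<Rightarrow> real^'n" where
  "curvature x u v w = d\<Gamma> x u v w - d\<Gamma> x v u w + \<Gamma> x u (\<Gamma> x v w) - \<Gamma> x v (\<Gamma> x u w)"

lemmas christoffel_expand = bilinear_expand[OF bilinear_christoffel_map]

lemma curvature_antisymmetric: "curvature x u v w = - curvature x v u w"
  by (simp add: curvature_def)

lemma bilinear_curvature:
  assumes "x \<in> V"
  shows "bilinear (\<lambda>u v. curvature x u v w)"
  unfolding bilinear_def curvature_def
  by (intro conjI allI linearI)
    (simp_all add: christoffel.expand[OF assms] algebra_simps)

lemma linear_curvature:
  assumes "x \<in> V"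
  shows "linear (curvature x u v)"
  unfolding curvature_def
  by (rule linearI) (simp_all add: christoffel.expand[OF assms] algebra_simps)

text \<open>Differentiating the compatibility of metric and connection once more expresses the second derivatives
of the metric by the connection; their symmetry is the claim.\<close>

lemma curvature_skew:
  assumes x: "x \<in> V"
  shows "g c x (curvature x a b w) s = - g c x w (curvature x a b s)"
proof -
  let ?L = "\<lambda>a b. field_derivative (g c) x b (\<Gamma> x a w) s + g c x (d\<Gamma> x b a w) s
    + (field_derivative (g c) x b w (\<Gamma> x a s) + g c x w (d\<Gamma> x b a s))"
  have d: "((\<lambda>y. field_derivative (g c) y a w s) has_derivative (\<lambda>b. ?L a b)) (at x)" for a
  proof (rule has_derivative_transform_within_open[OF _ open_domain x])
    show "((\<lambda>y. g c y (\<Gamma> y a w) s + g c y w (\<Gamma> y a s)) has_derivative (\<lambda>b. ?L a b)) (at x)"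
      using has_derivative_add[OF
          has_derivative[where p = "\<lambda>y. y" and u = "\<lambda>y. \<Gamma> y a w" and w = "\<lambda>y. s",
            OF x has_derivative_ident christoffel.has_derivative_fixed[OF x] has_derivative_const]
          has_derivative[where p = "\<lambda>y. y" and w = "\<lambda>y. \<Gamma> y a s" and u = "\<lambda>y. w",
            OF x has_derivative_ident has_derivative_const christoffel.has_derivative_fixed[OF x]]]
      by (simp add: expand[OF x])
  qed (simp add: metric_compatible)
  have "?L a b = ?L b a"
    by (rule second_derivative_symmetric[OF open_domain x has_derivative_fixed d d])
  then show ?thesis
    by (simp add: curvature_def metric_compatible[OF x] expand[OF x])
qed

end

section \<open>The Sasaki metric\<close>

lemma bounded_linear_base_part: "bounded_linear (base_part :: real^('n::finite + 'n) \<Rightarrow> real^'n)"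
  unfolding base_part_def
  by (rule linear_conv_bounded_linear[THEN iffD1], rule linearI) (auto simp: vec_eq_iff)

lemma bounded_linear_fibre_part: "bounded_linear (fibre_part :: real^('n::finite + 'n) \<Rightarrow> real^'n)"
  unfolding fibre_part_def
  by (rule linear_conv_bounded_linear[THEN iffD1], rule linearI) (auto simp: vec_eq_iff)

lemmas base_part_linear = linear_add[OF bounded_linear.linear[OF bounded_linear_base_part]]
  linear_cmul[OF bounded_linear.linear[OF bounded_linear_base_part]]
  linear_0[OF bounded_linear.linear[OF bounded_linear_base_part]]

lemmas fibre_part_linear = linear_add[OF bounded_linear.linear[OF bounded_linear_fibre_part]]
  linear_cmul[OF bounded_linear.linear[OF bounded_linear_fibre_part]]
  linear_0[OF bounded_linear.linear[OF bounded_linear_fibre_part]]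

lemmas has_derivative_base_part = bounded_linear.has_derivative[OF bounded_linear_base_part]
lemmas has_derivative_fibre_part = bounded_linear.has_derivative[OF bounded_linear_fibre_part]

lemma base_fibre_eqI:
  assumes "base_part z = base_part z'" "fibre_part z = fibre_part z'"
  shows "z = z'"
proof (rule vec_eq_iff[THEN iffD2], rule allI)
  fix a show "z $ a = z' $ a"
    using assms by (cases a) (auto simp: base_part_def fibre_part_def vec_eq_iff)
qed

lemma connection_map_eq:
  "connection_map g c z X = fibre_part X + christoffel_map g c (base_part z) (fibre_part z) (base_part X)"
  by (simp add: connection_map_def christoffel_map_def fibre_part_def base_part_def vec_eq_iff)

context smooth_metric_on_chart
begin

abbreviation connection ("\<kappa>") where "\<kappa> \<equiv> connection_map g c"

text \<open>The derivative, in the direction A, of the connection map applied to the constant vector B.\<close>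

definition connection_derivative ("d\<kappa>") where
  "d\<kappa> z A B = d\<Gamma> (base_part z) (base_part A) (fibre_part z) (base_part B)
     + \<Gamma> (base_part z) (fibre_part A) (base_part B)"

lemma linear_connection: "linear (\<kappa> z)"
  unfolding connection_map_eq
  by (rule linearI) (simp_all add: base_part_linear fibre_part_linear
      christoffel_expand algebra_simps)

lemma has_derivative_connection:
  assumes "base_part (f y) \<in> V" "(f has_derivative f') (at y)" "(v has_derivative v') (at y)"
  shows "((\<lambda>y. \<kappa> (f y) (v y)) has_derivative (\<lambda>E. d\<kappa> (f y) (f' E) (v y) + \<kappa> (f y) (v' E))) (at y)"
proof -
  have "((\<lambda>y. \<Gamma> (base_part (f y)) (fibre_part (f y)) (base_part (v y))) has_derivative
    (\<lambda>h. d\<Gamma> (base_part (f y)) (base_part (f' h)) (fibre_part (f y)) (base_part (v y)) +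
      \<Gamma> (base_part (f y)) (fibre_part (f' h)) (base_part (v y)) +
      \<Gamma> (base_part (f y)) (fibre_part (f y)) (base_part (v' h)))) (at y)"
    by (rule christoffel.has_derivative)
      (use assms in \<open>auto intro: has_derivative_base_part has_derivative_fibre_part\<close>)
  from has_derivative_add[OF has_derivative_fibre_part[OF assms(3)] this] show ?thesis
    unfolding connection_map_eq connection_derivative_def by (simp add: algebra_simps)
qed

lemma christoffel_derivative_symmetric:
  assumes "x \<in> V"
  shows "d\<Gamma> x a u w = d\<Gamma> x a w u"
  by (rule christoffel.field_derivative_eqI[OF assms _ christoffel.has_derivative_fixed[OF assms]])
    (rule christoffel_map_symmetric)

text \<open>The horizontal distribution fails to be integrable, and its obstruction is the curvature. This is the
source of the curvature terms in the Levi-Civita connection of the Sasaki metric.\<close>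

lemma connection_derivative_commute:
  assumes "base_part z \<in> V"
  shows "d\<kappa> z A B - d\<kappa> z B A = curvature (base_part z) (base_part A) (base_part B) (fibre_part z)
    + \<Gamma> (base_part z) (\<kappa> z A) (base_part B) - \<Gamma> (base_part z) (\<kappa> z B) (base_part A)"
  unfolding connection_derivative_def curvature_def connection_map_eq
  by (simp add: christoffel_expand christoffel_map_symmetric[OF assms, of _ "fibre_part z"]
      christoffel_map_symmetric[OF assms, of "base_part A" "\<Gamma> _ _ _"]
      christoffel_map_symmetric[OF assms, of "base_part B" "\<Gamma> _ _ _"]
      christoffel_derivative_symmetric[OF assms, of _ "fibre_part z"])

lemma has_derivative_sasaki:
  assumes "base_part z \<in> V"
  shows "((\<lambda>z. sasaki_metric A g (tangent_chart A c) z X Y) has_derivative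
    (\<lambda>C. field_derivative (g c) (base_part z) (base_part C) (base_part X) (base_part Y)
      + field_derivative (g c) (base_part z) (base_part C) (\<kappa> z X) (\<kappa> z Y)
      + g c (base_part z) (d\<kappa> z C X) (\<kappa> z Y) + g c (base_part z) (\<kappa> z X) (d\<kappa> z C Y))) (at z)"
proof -
  have k: "((\<lambda>z. \<kappa> z X) has_derivative (\<lambda>C. d\<kappa> z C X)) (at z)" for X
    using has_derivative_connection[OF assms has_derivative_ident has_derivative_const[of X]]
    by (simp add: linear_0[OF linear_connection])
  note b = has_derivative_base_part[OF has_derivative_ident]
  from has_derivative_add[OF has_derivative[where p = base_part and u = "\<lambda>_. base_part X" and w = "\<lambda>_. base_part Y",
        OF assms b has_derivative_const has_derivative_const] has_derivative[where p = base_part, OF assms b k k]]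
  show ?thesis
    by (simp add: sasaki_metric_tangent_chart expand[OF assms] add.assoc)
qed

lemma sasaki_metric_on_chart:
  "metric_on_chart (sasaki_metric A g) (tangent_chart A c) (base_part -` V)"
proof unfold_locales
  show "open (base_part -` V :: (real^('n + 'n)) set)"
    by (intro open_vimage open_domain bounded_linear.continuous_on[OF bounded_linear_base_part] continuous_on_id)
next
  fix z :: "real^('n + 'n)" assume z: "z \<in> base_part -` V"
  then have V: "base_part z \<in> V" by simp
  note k = linear_add[OF linear_connection] linear_cmul[OF linear_connection]
  show "bilinear (sasaki_metric A g (tangent_chart A c) z)"
    unfolding bilinear_def sasaki_metric_tangent_chart
    by (intro conjI allI linearI)
      (simp_all add: expand[OF V] base_part_linear k algebra_simps)
  show "(\<lambda>z. sasaki_metric A g (tangent_chart A c) z u w) differentiable (at z)" for u w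
    using has_derivative_sasaki[OF V] by (rule differentiableI)
  show "sasaki_metric A g (tangent_chart A c) z u w = sasaki_metric A g (tangent_chart A c) z w u" for u w
    unfolding sasaki_metric_tangent_chart using symmetric[OF V] by metis
  show "sasaki_metric A g (tangent_chart A c) z u u > 0" if "u \<noteq> 0" for u
  proof (cases "base_part u = 0")
    case True
    then have "fibre_part u \<noteq> 0"
      using that base_fibre_eqI[of u 0] by (auto simp: base_part_linear fibre_part_linear)
    then show ?thesis
      using True positive[OF V] by (simp add: sasaki_metric_tangent_chart expand[OF V] connection_map_eq christoffel_expand)
  next
    case False
    have "g c (base_part z) (\<kappa> z u) (\<kappa> z u) \<ge> 0"
      using positive[OF V, of "\<kappa> z u"] by (cases "\<kappa> z u = 0") (auto simp: expand[OF V])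
    then show ?thesis
      using positive[OF V False] by (simp add: sasaki_metric_tangent_chart)
  qed
qed

text \<open>With index lowered, the Christoffel map is half an alternating sum of derivatives of the metric. The
derivatives of the base metric are rewritten by metric compatibility, and the derivatives of the
connection map occur for each pair of arguments in both orders, and each exchange of the order
produces a curvature term.\<close>

lemma sasaki_christoffel:
  assumes V: "base_part z \<in> V"
  shows "sasaki_metric A g (tangent_chart A c) z
      (christoffel_map (sasaki_metric A g) (tangent_chart A c) z P Q) N =
    (let G = g c (base_part z); R = curvature (base_part z); \<xi> = fibre_part z;
         a = base_part P; b = base_part Q; n = base_part N
      in G (\<Gamma> (base_part z) a b) n
       + G (d\<kappa> z P Q + \<Gamma> (base_part z) a (\<kappa> z Q)) (\<kappa> z N)
       - G (R a b \<xi>) (\<kappa> z N) / 2 + G (\<kappa> z Q) (R a n \<xi>) / 2 + G (\<kappa> z P) (R b n \<xi>) / 2)"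
proof -
  interpret S: metric_on_chart "sasaki_metric A g" "tangent_chart A c" "base_part -` V"
    by (rule sasaki_metric_on_chart)
  define x \<xi> where "x = base_part z" and "\<xi> = fibre_part z"
  define a b n where "a = base_part P" and "b = base_part Q" and "n = base_part N"
  define \<alpha> \<beta> \<nu> where "\<alpha> = \<kappa> z P" and "\<beta> = \<kappa> z Q" and "\<nu> = \<kappa> z N"
  note defs = x_def \<xi>_def a_def b_def n_def \<alpha>_def \<beta>_def \<nu>_def
  let ?g = "g c x" and ?dg = "field_derivative (g c) x"
  have x: "x \<in> V" using V by (simp add: x_def)
  have sym: "?g u w = ?g w u" for u w using symmetric[OF x] .
  have Gsym: "\<Gamma> x u w = \<Gamma> x w u" for u w using christoffel_map_symmetric[OF x] .
  have DS: "field_derivative (sasaki_metric A g (tangent_chart A c)) z C X Y =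
    ?dg (base_part C) (base_part X) (base_part Y) + ?dg (base_part C) (\<kappa> z X) (\<kappa> z Y)
      + ?g (d\<kappa> z C X) (\<kappa> z Y) + ?g (\<kappa> z X) (d\<kappa> z C Y)" for C X Y
    using S.field_derivative_eqI[OF _ refl has_derivative_sasaki[OF V]] V by (simp add: x_def)
  have lower: "?g (\<Gamma> x a b) n = (?dg a b n + ?dg b a n - ?dg n a b) / 2"
    by (rule christoffel_map_lower[OF x])
  have c1: "?dg a \<beta> \<nu> = ?g (\<Gamma> x a \<beta>) \<nu> + ?g \<beta> (\<Gamma> x a \<nu>)"
    by (rule metric_compatible[OF x])
  have c2: "?dg b \<alpha> \<nu> = ?g (\<Gamma> x b \<alpha>) \<nu> + ?g \<alpha> (\<Gamma> x b \<nu>)"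
    by (rule metric_compatible[OF x])
  have c3: "?dg n \<alpha> \<beta> = ?g \<beta> (\<Gamma> x n \<alpha>) + ?g \<alpha> (\<Gamma> x n \<beta>)"
    using metric_compatible[OF x] sym by metis
  have comm: "d\<kappa> z A B = d\<kappa> z B A + curvature x (base_part A) (base_part B) \<xi>
    + \<Gamma> x (base_part B) (\<kappa> z A) - \<Gamma> x (base_part A) (\<kappa> z B)" for A B
    using connection_derivative_commute[OF V, of A B, folded x_def \<xi>_def]
      Gsym[of "\<kappa> z A" "base_part B"] Gsym[of "\<kappa> z B" "base_part A"]
    by (simp add: algebra_simps)
  have k1: "?g \<beta> (d\<kappa> z P N) = ?g \<beta> (d\<kappa> z N P) + ?g \<beta> (curvature x a n \<xi>) + ?g \<beta> (\<Gamma> x n \<alpha>) - ?g \<beta> (\<Gamma> x a \<nu>)"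
    using comm[of P N, folded a_def n_def \<alpha>_def \<nu>_def] by (simp add: expand[OF x])
  have k2: "?g \<alpha> (d\<kappa> z Q N) = ?g \<alpha> (d\<kappa> z N Q) + ?g \<alpha> (curvature x b n \<xi>) + ?g \<alpha> (\<Gamma> x n \<beta>) - ?g \<alpha> (\<Gamma> x b \<nu>)"
    using comm[of Q N, folded b_def n_def \<beta>_def \<nu>_def] by (simp add: expand[OF x])
  have k3: "?g (d\<kappa> z P Q) \<nu> = ?g (d\<kappa> z Q P) \<nu> + ?g (curvature x a b \<xi>) \<nu> + ?g (\<Gamma> x b \<alpha>) \<nu> - ?g (\<Gamma> x a \<beta>) \<nu>"
    using comm[of P Q, folded a_def b_def \<alpha>_def \<beta>_def] by (simp add: expand[OF x])
  have s1: "?g (d\<kappa> z N P) \<beta> = ?g \<beta> (d\<kappa> z N P)" by (rule sym)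
  have "sasaki_metric A g (tangent_chart A c) z
      (christoffel_map (sasaki_metric A g) (tangent_chart A c) z P Q) N =
    ((?dg a b n + ?dg a \<beta> \<nu> + ?g (d\<kappa> z P Q) \<nu> + ?g \<beta> (d\<kappa> z P N))
    + (?dg b a n + ?dg b \<alpha> \<nu> + ?g (d\<kappa> z Q P) \<nu> + ?g \<alpha> (d\<kappa> z Q N))
    - (?dg n a b + ?dg n \<alpha> \<beta> + ?g \<beta> (d\<kappa> z N P) + ?g \<alpha> (d\<kappa> z N Q))) / 2"
    using S.christoffel_map_lower[of z P Q N, unfolded DS, folded a_def b_def n_def \<alpha>_def \<beta>_def \<nu>_def] V s1
    by simp
  also have "\<dots> = ?g (\<Gamma> x a b) n + ?g (d\<kappa> z P Q + \<Gamma> x a \<beta>) \<nu>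
       - ?g (curvature x a b \<xi>) \<nu> / 2 + ?g \<beta> (curvature x a n \<xi>) / 2 + ?g \<alpha> (curvature x b n \<xi>) / 2"
    unfolding lower c1 c2 c3 k1 k2 bilinear_ladd[OF bilinear[OF x]] k3
    by (simp add: field_simps)
  finally show ?thesis by (simp add: defs Let_def)
qed

end

section \<open>Totally geodesic hypersurfaces of the tangent bundle\<close>

context smooth_metric_on_chart
begin

definition covariant_derivative ::
  "('t::real_normed_vector \<Rightarrow> real^'n) \<Rightarrow> ('t \<Rightarrow> real^'n) \<Rightarrow> 't \<Rightarrow> 't \<Rightarrow> real^'n" where
  "covariant_derivative x w y E =
     frechet_derivative w (at y) E + \<Gamma> (x y) (frechet_derivative x (at y) E) (w y)"

lemma covariant_derivative_eq:
  assumes "(x has_derivative x') (at y)" "(w has_derivative w') (at y)"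
  shows "covariant_derivative x w y E = w' E + \<Gamma> (x y) (x' E) (w y)"
  using frechet_derivative_at[OF assms(1)] frechet_derivative_at[OF assms(2)]
  by (simp add: covariant_derivative_def)

lemma has_derivative_metric_along:
  assumes "x y \<in> V" and x: "x differentiable (at y)"
    and u: "u differentiable (at y)" and w: "w differentiable (at y)"
  shows "((\<lambda>y. g c (x y) (u y) (w y)) has_derivative
    (\<lambda>E. g c (x y) (covariant_derivative x u y E) (w y) + g c (x y) (u y) (covariant_derivative x w y E))) (at y)"
  using has_derivative[OF assms(1) x[unfolded frechet_derivative_works]
      u[unfolded frechet_derivative_works] w[unfolded frechet_derivative_works]]
  by (simp add: covariant_derivative_def metric_compatible[OF assms(1)] expand[OF assms(1)] algebra_simps)

text \<open>A map f into the tangent bundle has a velocity in each parameter direction E. Its image under the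
differential of the bundle projection is the horizontal velocity, its image under the connection map
the vertical velocity; the latter is also the covariant derivative of the fibre part of f.\<close>

definition horizontal_velocity :: "('t::real_normed_vector \<Rightarrow> real^('n + 'n)) \<Rightarrow> 't \<Rightarrow> 't \<Rightarrow> real^'n" where
  "horizontal_velocity f E y = base_part (frechet_derivative f (at y) E)"

definition vertical_velocity :: "('t::real_normed_vector \<Rightarrow> real^('n + 'n)) \<Rightarrow> 't \<Rightarrow> 't \<Rightarrow> real^'n" where
  "vertical_velocity f E y = \<kappa> (f y) (frechet_derivative f (at y) E)"

lemma has_derivative_base:
  assumes "f differentiable (at y)"
  shows "((\<lambda>y. base_part (f y)) has_derivative (\<lambda>E. horizontal_velocity f E y)) (at y)"
  using has_derivative_base_part[OF assms[unfolded frechet_derivative_works]]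
  by (simp add: horizontal_velocity_def)

lemma has_derivative_fibre:
  assumes "f differentiable (at y)" "base_part (f y) \<in> V"
  shows "((\<lambda>y. fibre_part (f y)) has_derivative
    (\<lambda>E. vertical_velocity f E y - \<Gamma> (base_part (f y)) (horizontal_velocity f E y) (fibre_part (f y)))) (at y)"
  using has_derivative_fibre_part[OF assms(1)[unfolded frechet_derivative_works]]
  by (simp add: horizontal_velocity_def vertical_velocity_def connection_map_eq
      christoffel_map_symmetric[OF assms(2), of "fibre_part (f y)"])

lemma covariant_derivative_fibre:
  assumes "f differentiable (at y)" "base_part (f y) \<in> V"
  shows "covariant_derivative (\<lambda>y. base_part (f y)) (\<lambda>y. fibre_part (f y)) y E = vertical_velocity f E y"
  using covariant_derivative_eq[OF has_derivative_base[OF assms(1)] has_derivative_fibre[OF assms]] by simp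

text \<open>The ambient derivative of one velocity along another, paired with N. Up to curvature terms the
horizontal and vertical parts are differentiated separately by the connection of the base.\<close>

lemma gauss_formula:
  assumes V: "base_part (f y) \<in> V" and f: "f differentiable (at y)"
    and f': "(\<lambda>y. frechet_derivative f (at y) Q) differentiable (at y)"
  defines "D \<equiv> covariant_derivative (\<lambda>y. base_part (f y))"
    and "G \<equiv> g c (base_part (f y))" and "R \<equiv> curvature (base_part (f y))"
    and "X \<equiv> horizontal_velocity f" and "Z \<equiv> vertical_velocity f"
  shows "sasaki_metric A g (tangent_chart A c) (f y)
      (frechet_derivative (\<lambda>y. frechet_derivative f (at y) Q) (at y) P
        + christoffel_map (sasaki_metric A g) (tangent_chart A c) (f y)
            (frechet_derivative f (at y) P) (frechet_derivative f (at y) Q)) N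
    = G (D (X Q) y P) (base_part N) + G (D (Z Q) y P) (\<kappa> (f y) N)
      - G (R (X P y) (X Q y) (fibre_part (f y))) (\<kappa> (f y) N) / 2
      + G (Z Q y) (R (X P y) (base_part N) (fibre_part (f y))) / 2
      + G (Z P y) (R (X Q y) (base_part N) (fibre_part (f y))) / 2"
proof -
  interpret S: metric_on_chart "sasaki_metric A g" "tangent_chart A c" "base_part -` V"
    by (rule sasaki_metric_on_chart)
  have V': "f y \<in> base_part -` V" using V by simp
  define h where "h = frechet_derivative (\<lambda>y. frechet_derivative f (at y) Q) (at y) P"
  note f'' = f'[unfolded frechet_derivative_works]
  have 1: "D (X Q) y P = base_part h + \<Gamma> (base_part (f y)) (X P y) (X Q y)"
    unfolding D_def
    using covariant_derivative_eq[OF has_derivative_base[OF f] has_derivative_base_part[OF f'']]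
    by (simp add: h_def X_def horizontal_velocity_def[abs_def])
  have 2: "D (Z Q) y P = d\<kappa> (f y) (frechet_derivative f (at y) P) (frechet_derivative f (at y) Q)
      + \<kappa> (f y) h + \<Gamma> (base_part (f y)) (X P y) (Z Q y)"
    unfolding D_def
    using covariant_derivative_eq[OF has_derivative_base[OF f]
        has_derivative_connection[OF V f[unfolded frechet_derivative_works] f'']]
    by (simp add: h_def X_def Z_def horizontal_velocity_def[abs_def] vertical_velocity_def[abs_def])
  have "sasaki_metric A g (tangent_chart A c) (f y) h N =
    G (base_part h) (base_part N) + G (\<kappa> (f y) h) (\<kappa> (f y) N)"
    by (simp add: sasaki_metric_tangent_chart G_def)
  then show ?thesis
    unfolding h_def[symmetric] 1 2 bilinear_ladd[OF S.bilinear[OF V']]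
      sasaki_christoffel[OF V]
    by (simp add: G_def R_def X_def Z_def horizontal_velocity_def vertical_velocity_def Let_def
        bilinear_ladd[OF bilinear[OF V]])
qed

end

text \<open>A parametrised totally geodesic hypersurface f together with a unit normal field, given by its
horizontal part p and its vertical part q. Codimension one is expressed by \<open>spanning\<close>: a velocity
and a multiple of the normal add up to any prescribed pair of parts. In \<open>geodesic\<close>, the vector N
ranges over all normal vectors at a point, and P and Q over all pairs of directions.\<close>

locale geodesic_hypersurface = smooth_metric_on_chart g c V
  for g :: "('p, 'n::finite) metric_field" and c :: "('p, 'n) chart" and V :: "(real^'n) set" +
  fixes A :: "('p, 'n) chart set" and U :: "'t::euclidean_space set"
    and f :: "'t \<Rightarrow> real^('n + 'n)" and p q :: "'t \<Rightarrow> real^'n"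
  assumes open_parameters: "open U"
    and base_in_chart: "y \<in> U \<Longrightarrow> base_part (f y) \<in> V"
    and differentiable_map: "y \<in> U \<Longrightarrow> f differentiable (at y)"
    and differentiable_velocity: "y \<in> U \<Longrightarrow> (\<lambda>y. frechet_derivative f (at y) E) differentiable (at y)"
    and differentiable_horizontal_normal: "y \<in> U \<Longrightarrow> p differentiable (at y)"
    and differentiable_vertical_normal: "y \<in> U \<Longrightarrow> q differentiable (at y)"
    and orthogonal: "y \<in> U \<Longrightarrow> g c (base_part (f y)) (horizontal_velocity f E y) (p y)
      + g c (base_part (f y)) (vertical_velocity f E y) (q y) = 0"
    and unit: "y \<in> U \<Longrightarrow> g c (base_part (f y)) (p y) (p y) + g c (base_part (f y)) (q y) (q y) = 1"
    and spanning: "y \<in> U \<Longrightarrow>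
      \<exists>E t. u = horizontal_velocity f E y + t *\<^sub>R p y \<and> w = vertical_velocity f E y + t *\<^sub>R q y"
    and geodesic: "y \<in> U \<Longrightarrow>
      (\<And>E. sasaki_metric A g (tangent_chart A c) (f y) (frechet_derivative f (at y) E) N = 0) \<Longrightarrow>
      sasaki_metric A g (tangent_chart A c) (f y)
      (frechet_derivative (\<lambda>y. frechet_derivative f (at y) Q) (at y) P
        + christoffel_map (sasaki_metric A g) (tangent_chart A c) (f y)
            (frechet_derivative f (at y) P) (frechet_derivative f (at y) Q)) N = 0"
begin

abbreviation base_point ("\<pi>") where "\<pi> y \<equiv> base_part (f y)"
abbreviation fibre_point ("\<xi>") where "\<xi> y \<equiv> fibre_part (f y)"
abbreviation horizontal ("X") where "X \<equiv> horizontal_velocity f"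
abbreviation vertical ("Z") where "Z \<equiv> vertical_velocity f"
abbreviation covariant ("D") where "D \<equiv> covariant_derivative \<pi>"

lemma tangent_vector_ex:
  assumes y: "y \<in> U" and "g c (\<pi> y) u (p y) + g c (\<pi> y) w (q y) = 0"
  obtains E where "X E y = u" "Z E y = w"
proof -
  obtain E t where E: "u = X E y + t *\<^sub>R p y" "w = Z E y + t *\<^sub>R q y"
    using spanning[OF y] by blast
  have "t = t * (g c (\<pi> y) (p y) (p y) + g c (\<pi> y) (q y) (q y))"
    using unit[OF y] by simp
  also have "\<dots> = 0"
    using assms(2) orthogonal[OF y, of E] unfolding E
    by (simp add: expand[OF base_in_chart[OF y]] algebra_simps)
  finally show ?thesis using that E by simp
qed

lemma differentiable_base: "y \<in> U \<Longrightarrow> \<pi> differentiable (at y)"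
  using has_derivative_base[OF differentiable_map] differentiableI by blast

lemma has_derivative_horizontal:
  assumes y: "y \<in> U"
  shows "(X E has_derivative (\<lambda>h. base_part (frechet_derivative (\<lambda>y. frechet_derivative f (at y) E) (at y) h))) (at y)"
  unfolding horizontal_velocity_def
  by (rule has_derivative_base_part[OF differentiable_velocity[OF y, unfolded frechet_derivative_works]])

lemma second_velocity_symmetric:
  assumes y: "y \<in> U"
  shows "frechet_derivative (\<lambda>y. frechet_derivative f (at y) E) (at y) F =
    frechet_derivative (\<lambda>y. frechet_derivative f (at y) F) (at y) E"
  by (rule second_derivative_symmetric[where f = f and f' = "\<lambda>y. frechet_derivative f (at y)", OF open_parameters y])
    (use differentiable_map differentiable_velocity[OF y] in \<open>simp_all flip: frechet_derivative_works\<close>)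

lemma differentiable_vertical:
  assumes y: "y \<in> U"
  shows "Z E differentiable (at y)"
  unfolding vertical_velocity_def
  by (rule differentiableI[OF has_derivative_connection[OF base_in_chart[OF y]
      differentiable_map[OF y, unfolded frechet_derivative_works]
      differentiable_velocity[OF y, unfolded frechet_derivative_works]]])

text \<open>The unit normal field of a totally geodesic hypersurface is parallel for the Sasaki connection; this is
that statement, tested against an arbitrary vector with horizontal part u and vertical part w.
For tangent vectors it comes from differentiating orthogonality and inserting the Gauss formula with
vanishing second fundamental form, for the normal itself from differentiating the unit length.\<close>

lemma normal_derivative:
  assumes y: "y \<in> U"
  shows "g c (\<pi> y) u (D p y E) + g c (\<pi> y) w (D q y E) =
    - g c (\<pi> y) (curvature (\<pi> y) (X E y) u (\<xi> y)) (q y) / 2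
    + g c (\<pi> y) w (curvature (\<pi> y) (X E y) (p y) (\<xi> y)) / 2
    + g c (\<pi> y) (Z E y) (curvature (\<pi> y) u (p y) (\<xi> y)) / 2"
proof -
  let ?g = "g c (\<pi> y)" and ?R = "curvature (\<pi> y)"
  note V = base_in_chart[OF y]
  note dp = differentiable_horizontal_normal[OF y] and dq = differentiable_vertical_normal[OF y]
  have sym: "?g a b = ?g b a" for a b by (rule symmetric[OF V])
  \<comment> \<open>the normal vector with horizontal part p and vertical part q, in induced coordinates\<close>
  define N where "N = (\<chi> a. case a of Inl i \<Rightarrow> p y $ i
    | Inr i \<Rightarrow> (q y - \<Gamma> (\<pi> y) (\<xi> y) (p y)) $ i)"
  have Nb: "base_part N = p y" by (simp add: N_def base_part_def vec_eq_iff)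
  have "fibre_part N = q y - \<Gamma> (\<pi> y) (\<xi> y) (p y)" by (simp add: N_def fibre_part_def vec_eq_iff)
  then have Nk: "\<kappa> (f y) N = q y" by (simp add: connection_map_eq Nb)
  have normal: "sasaki_metric A g (tangent_chart A c) (f y) (frechet_derivative f (at y) E) N = 0" for E
    using orthogonal[OF y, of E]
    by (simp add: sasaki_metric_tangent_chart Nb Nk horizontal_velocity_def vertical_velocity_def)
  let ?\<Phi> = "\<lambda>u w. ?g u (D p y E) + ?g w (D q y E) + ?g (?R (X E y) u (\<xi> y)) (q y) / 2
    - ?g w (?R (X E y) (p y) (\<xi> y)) / 2 - ?g (Z E y) (?R u (p y) (\<xi> y)) / 2"
  have tangential: "?\<Phi> (X F y) (Z F y) = 0" for F
  proof -
    \<comment> \<open>the second fundamental form in the direction of the normal, written out by the Gauss formula\<close>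
    have II: "?g (D (X F) y E) (p y) + ?g (D (Z F) y E) (q y)
      - ?g (?R (X E y) (X F y) (\<xi> y)) (q y) / 2
      + ?g (Z F y) (?R (X E y) (p y) (\<xi> y)) / 2 + ?g (Z E y) (?R (X F y) (p y) (\<xi> y)) / 2 = 0"
      using geodesic[OF y normal, of F E]
      unfolding gauss_formula[OF V differentiable_map[OF y] differentiable_velocity[OF y]] Nb Nk .
    have "((\<lambda>y. g c (\<pi> y) (X F y) (p y) + g c (\<pi> y) (Z F y) (q y)) has_derivative (\<lambda>E.
        (?g (D (X F) y E) (p y) + ?g (X F y) (D p y E)) + (?g (D (Z F) y E) (q y) + ?g (Z F y) (D q y E)))) (at y)"
      by (intro has_derivative_add has_derivative_metric_along V differentiable_base[OF y] dp dq
          differentiable_vertical[OF y] differentiableI[OF has_derivative_horizontal[OF y]])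
    moreover have "((\<lambda>y. g c (\<pi> y) (X F y) (p y) + g c (\<pi> y) (Z F y) (q y)) has_derivative (\<lambda>E. 0)) (at y)"
      by (rule has_derivative_transform_within_open[OF has_derivative_const open_parameters y])
        (simp add: orthogonal)
    from fun_cong[OF has_derivative_unique[OF calculation this], of E] have "(?g (D (X F) y E) (p y) + ?g (X F y) (D p y E)) + (?g (D (Z F) y E) (q y) + ?g (Z F y) (D q y E)) = 0"
      by simp
    then show ?thesis using II by linarith
  qed
  have normal_part: "?\<Phi> (p y) (q y) = 0"
  proof -
    have "((\<lambda>y. g c (\<pi> y) (p y) (p y) + g c (\<pi> y) (q y) (q y)) has_derivative (\<lambda>E.
        (?g (D p y E) (p y) + ?g (p y) (D p y E)) + (?g (D q y E) (q y) + ?g (q y) (D q y E)))) (at y)"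
      by (intro has_derivative_add has_derivative_metric_along V differentiable_base[OF y] dp dq)
    moreover have "((\<lambda>y. g c (\<pi> y) (p y) (p y) + g c (\<pi> y) (q y) (q y)) has_derivative (\<lambda>E. 0)) (at y)"
      by (rule has_derivative_transform_within_open[OF has_derivative_const open_parameters y])
        (simp add: unit)
    from fun_cong[OF has_derivative_unique[OF calculation this], of E] have "(?g (D p y E) (p y) + ?g (p y) (D p y E)) + (?g (D q y E) (q y) + ?g (q y) (D q y E)) = 0"
      by simp
    moreover have "?R (p y) (p y) (\<xi> y) = 0"
      using curvature_antisymmetric[of "\<pi> y" "p y" "p y" "\<xi> y"] by (simp add: eq_neg_iff_add_eq_0 flip: scaleR_2)
    ultimately show ?thesis
      using sym[of "D p y E" "p y"] sym[of "D q y E" "q y"] sym[of "q y" "?R (X E y) (p y) (\<xi> y)"]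
      by (simp add: expand[OF V])
  qed
  obtain F t where F: "u = X F y + t *\<^sub>R p y" "w = Z F y + t *\<^sub>R q y"
    using spanning[OF y] by blast
  have "?\<Phi> u w = ?\<Phi> (X F y) (Z F y) + t * ?\<Phi> (p y) (q y)"
    unfolding F
    by (simp add: expand[OF V] bilinear_expand[OF bilinear_curvature[OF V]] algebra_simps add_divide_distrib)
  then have "?\<Phi> u w = 0" using tangential normal_part by simp
  then show ?thesis by linarith
qed

lemma vertical_normal_derivative:
  assumes y: "y \<in> U"
  shows "D q y E = (1 / 2) *\<^sub>R curvature (\<pi> y) (X E y) (p y) (\<xi> y)"
proof (rule nondegenerate_eq[OF base_in_chart[OF y]])
  fix w
  note V = base_in_chart[OF y]
  show "g c (\<pi> y) (D q y E) w = g c (\<pi> y) ((1 / 2) *\<^sub>R curvature (\<pi> y) (X E y) (p y) (\<xi> y)) w"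
    using normal_derivative[OF y, of 0 E w] symmetric[OF V, of "D q y E" w]
      symmetric[OF V, of "curvature (\<pi> y) (X E y) (p y) (\<xi> y)" w]
    by (simp add: expand[OF V] bilinear_expand[OF bilinear_curvature[OF V]])
qed

lemma horizontal_normal_derivative:
  assumes y: "y \<in> U"
  shows "g c (\<pi> y) u (D p y E) =
    - g c (\<pi> y) (curvature (\<pi> y) (X E y) u (\<xi> y)) (q y) / 2
    + g c (\<pi> y) (Z E y) (curvature (\<pi> y) u (p y) (\<xi> y)) / 2"
  using normal_derivative[OF y, of u E 0] by (simp add: expand[OF base_in_chart[OF y]])

text \<open>A parallel vector field satisfies a linear first-order system, and the symmetry of its second
derivatives says that the curvature annihilates it.\<close>

lemma parallel_vertical_normal_curvature:
  assumes U': "open U'" "U' \<subseteq> U" "y \<in> U'" and parallel: "\<And>y E. y \<in> U' \<Longrightarrow> D q y E = 0"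
  shows "curvature (\<pi> y) (X E y) (X F y) (q y) = 0"
proof -
  have y: "y \<in> U" using U' by blast
  note V = base_in_chart[OF y]
  let ?h = "\<lambda>E F. base_part (frechet_derivative (\<lambda>y. frechet_derivative f (at y) E) (at y) F)"
  let ?L = "\<lambda>E F. - (d\<Gamma> (\<pi> y) (X F y) (X E y) (q y) + \<Gamma> (\<pi> y) (?h E F) (q y)
        + \<Gamma> (\<pi> y) (X E y) (- \<Gamma> (\<pi> y) (X F y) (q y)))"
  have q': "(q has_derivative (\<lambda>E. - \<Gamma> (\<pi> z) (X E z) (q z))) (at z)" if "z \<in> U'" for z
  proof -
    have z: "z \<in> U" using that U' by blast
    have "frechet_derivative q (at z) E = - \<Gamma> (\<pi> z) (X E z) (q z)" for E
      using parallel[OF that, of E] covariant_derivative_eq[OF has_derivative_base[OF differentiable_map[OF z]]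
          differentiable_vertical_normal[OF z, unfolded frechet_derivative_works], of E]
      by (simp add: eq_neg_iff_add_eq_0)
    then show ?thesis
      using differentiable_vertical_normal[OF z, unfolded frechet_derivative_works] by presburger
  qed
  have L: "((\<lambda>z. - \<Gamma> (\<pi> z) (X E z) (q z)) has_derivative ?L E) (at y)" for E
    by (intro has_derivative_minus christoffel.has_derivative V has_derivative_base
        differentiable_map y has_derivative_horizontal q' U')
  have "?L E F = ?L F E"
    by (rule second_derivative_symmetric[OF U'(1,3) q' L L])
  moreover have "?h E F = ?h F E"
    by (rule arg_cong[OF second_velocity_symmetric[OF y]])
  ultimately show ?thesis
    by (simp add: curvature_def christoffel.expand[OF V] algebra_simps)
qed

end

section \<open>Surfaces of nonvanishing curvature\<close>

lemma open_nonvanishing: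
  fixes f :: "'a::topological_space \<Rightarrow> 'b::real_normed_vector"
  assumes "open U" "continuous_on U f"
  shows "open {y \<in> U. f y \<noteq> 0}"
proof -
  have "{y \<in> U. f y \<noteq> 0} = U \<inter> f -` (- {0})" by auto
  moreover have "open (U \<inter> f -` (- {0}))"
    by (rule continuous_open_preimage[OF assms(2,1)]) (simp add: open_Compl)
  ultimately show ?thesis by simp
qed

text \<open>The coordinate area form. On a surface it carries the dependence of the curvature on its first two
arguments, and up to a scalar also the dependence of the lowered curvature on the last two.\<close>

definition area :: "real^2 \<Rightarrow> real^2 \<Rightarrow> real" where
  "area u v = u $ 1 * v $ 2 - u $ 2 * v $ 1"

lemma bounded_bilinear_area: "bounded_bilinear area"
  unfolding bilinear_conv_bounded_bilinear[symmetric] bilinear_def area_def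
  by (intro conjI allI linearI) (simp_all add: algebra_simps)

lemma area_zero [simp]: "area 0 v = 0" "area v 0 = 0"
  by (simp_all add: area_def)

lemma eq_zero_if_area_zero:
  assumes "\<And>v. area v w = 0"
  shows "w = 0"
  using assms[of "axis 1 1"] assms[of "axis 2 1"]
  by (simp add: area_def axis_def vec_eq_iff forall_2)

lemma parallel_if_area_zero:
  assumes "area u v = 0" "u \<noteq> 0"
  obtains t where "v = t *\<^sub>R u"
proof (cases "u $ 1 = 0")
  case True
  then have "u $ 2 \<noteq> 0" using assms(2) by (auto simp: vec_eq_iff forall_2)
  then show ?thesis
    using that[of "v $ 2 / u $ 2"] assms(1) True by (simp add: area_def vec_eq_iff forall_2)
next
  case False
  then show ?thesis
    using that[of "v $ 1 / u $ 1"] assms(1) by (simp add: area_def vec_eq_iff forall_2 field_simps)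
qed

lemma alternating_eq_area:
  fixes B :: "real^2 \<Rightarrow> real^2 \<Rightarrow> 'b::real_vector"
  assumes B: "bilinear B" and alt: "\<And>u v. B u v = - B v u"
  shows "B u v = area u v *\<^sub>R B (axis 1 1) (axis 2 1)"
proof -
  have "B w w = 0" for w
  proof -
    have "2 *\<^sub>R B w w = 0" using alt[of w w] by (simp add: scaleR_2 eq_neg_iff_add_eq_0)
    then show ?thesis by simp
  qed
  then show ?thesis
    using alt[of "axis 2 1" "axis 1 1"]
    by (subst bilinear_axis_expansion[OF B]) (simp add: sum_2 area_def scaleR_diff_left)
qed

context smooth_metric_on_chart
begin

lemma C_k_on_curvature: "C_k_on k V (\<lambda>x. curvature x u v w)"
proof (rule C_k_on_of_axis_components[OF open_domain])
  fix l
  have G: "C_k_on k V (\<lambda>x. (\<Gamma> x a b) $ l)" for a b l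
    by (rule C_k_on_bounded_linear[OF open_domain bounded_linear_vec_nth C_k_on_christoffel_map])
  have GG: "C_k_on k V (\<lambda>x. \<Gamma> x a (\<Gamma> x b w) $ l)" for a b
  proof (rule C_k_on_cong[OF open_domain])
    show "C_k_on k V (\<lambda>x. \<Sum>i\<in>UNIV. (\<Gamma> x b w) $ i * (\<Gamma> x a (axis i 1)) $ l)"
      by (intro C_k_on_sum C_k_on_mult open_domain G)
    show "(\<Sum>i\<in>UNIV. (\<Gamma> x b w) $ i * (\<Gamma> x a (axis i 1)) $ l) = \<Gamma> x a (\<Gamma> x b w) $ l" for x
      using linear_axis_expansion[of "\<Gamma> x a" "\<Gamma> x b w"] bilinear_christoffel_map[of g c x]
      by (simp add: bilinear_def)
  qed
  have dG: "C_k_on k V (\<lambda>x. d\<Gamma> x a b w $ l)" for a b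
    by (rule C_k_on_bounded_linear[OF open_domain bounded_linear_vec_nth C_k_on_christoffel_derivative])
  have minus: "C_k_on k V (\<lambda>x. - h x)" if "C_k_on k V h" for h :: "_ \<Rightarrow> real"
    by (rule C_k_on_bounded_linear[OF open_domain bounded_linear_minus[OF bounded_linear_ident] that])
  show "C_k_on k V (\<lambda>x. curvature x u v w $ l)"
    unfolding curvature_def diff_conv_add_uminus vector_add_component vector_uminus_component
    by (intro C_k_on_add open_domain minus dG GG)
qed

sublocale curvature: bilinear_field V "\<lambda>x u w. curvature x u v w" for v
proof
  show "bilinear (\<lambda>u w. curvature x u v w)" if "x \<in> V" for x
    using bilinear_curvature[OF that] linear_curvature[OF that] by (auto simp: bilinear_def)
  show "(\<lambda>x. curvature x u v w) differentiable (at x)" if "x \<in> V" for x u w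
    using C_k_on_curvature[of "Suc 0"] that by (rule C_k_on_imp_differentiable)
qed (rule open_domain)

end

locale smooth_metric_on_surface_chart = smooth_metric_on_chart g c V
  for g :: "('p, 2) metric_field" and c :: "('p, 2) chart" and V :: "(real^2) set"
begin

text \<open>The curvature endomorphism of the coordinate bivector. Being skew for the metric, it is a multiple of
the rotation by a right angle.\<close>

definition rotation :: "real^2 \<Rightarrow> real^2 \<Rightarrow> real^2" ("\<R>") where
  "\<R> x w = curvature x (axis 1 1) (axis 2 1) w"

text \<open>The numerator of the Gaussian curvature.\<close>

definition curvature_scalar :: "real^2 \<Rightarrow> real" where
  "curvature_scalar x = g c x (\<R> x (axis 2 1)) (axis 1 1)"

lemma curvature_eq_rotation:
  assumes "x \<in> V"
  shows "curvature x u v w = area u v *\<^sub>R \<R> x w"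
  unfolding rotation_def
  by (rule alternating_eq_area[OF bilinear_curvature[OF assms]]) (rule curvature_antisymmetric)

lemma linear_rotation: "x \<in> V \<Longrightarrow> linear (\<R> x)"
  unfolding rotation_def by (rule linear_curvature)

lemma rotation_skew: "x \<in> V \<Longrightarrow> g c x (\<R> x w) s = - g c x w (\<R> x s)"
  unfolding rotation_def by (rule curvature_skew)

lemma rotation_eq_area:
  assumes x: "x \<in> V"
  shows "g c x (\<R> x w) s = area s w * curvature_scalar x"
proof -
  have "bilinear (\<lambda>s w. g c x (\<R> x w) s)"
    using linear_rotation[OF x] by (simp add: bilinear_def linear_iff expand[OF x])
  moreover have "g c x (\<R> x w) s = - g c x (\<R> x s) w" for s w
    using rotation_skew[OF x, of w s] symmetric[OF x, of w "\<R> x s"] by (rule trans[OF _ arg_cong])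
  ultimately have "g c x (\<R> x w) s = area s w *\<^sub>R g c x (\<R> x (axis 2 1)) (axis 1 1)"
    by (rule alternating_eq_area)
  then show ?thesis
    by (simp only: curvature_scalar_def real_scaleR_def)
qed

lemma orthogonal_vector_ex:
  assumes x: "x \<in> V" and q: "q \<noteq> 0"
  obtains \<zeta> where "\<zeta> \<noteq> 0" "g c x \<zeta> q = 0"
proof
  let ?a = "g c x (axis 1 1) q" and ?b = "g c x (axis 2 1) q"
  let ?\<zeta> = "?b *\<^sub>R axis 1 1 - ?a *\<^sub>R axis 2 1 :: real^2"
  show "g c x ?\<zeta> q = 0" by (simp add: expand[OF x])
  show "?\<zeta> \<noteq> 0"
  proof
    assume z: "?\<zeta> = 0"
    have "?b = ?\<zeta> $ 1" "?a = - ?\<zeta> $ 2" by (simp_all add: axis_def)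
    then have "?a = 0" "?b = 0" unfolding z by simp_all
    moreover have "linear (\<lambda>w. g c x w q)" using bilinear[OF x] by (simp add: bilinear_def)
    from linear_axis_expansion[OF this, of q] have "g c x q q = q $ 1 * ?a + q $ 2 * ?b"
      by (simp add: sum_2)
    ultimately have "g c x q q = 0" by simp
    then show False using positive[OF x q] by simp
  qed
qed

end

locale geodesic_hypersurface_over_surface =
  geodesic_hypersurface g c V A U f p q + smooth_metric_on_surface_chart g c V
  for g :: "('p, 2) metric_field" and c :: "('p, 2) chart" and V :: "(real^2) set"
    and A :: "('p, 2) chart set" and U :: "'t::euclidean_space set"
    and f :: "'t \<Rightarrow> real^(2 + 2)" and p q :: "'t \<Rightarrow> real^2" +
  assumes curved: "y \<in> U \<Longrightarrow> curvature_scalar (\<pi> y) \<noteq> 0"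
begin

lemma rotation_injective:
  assumes y: "y \<in> U" and "\<R> (\<pi> y) w = 0"
  shows "w = 0"
proof (rule eq_zero_if_area_zero)
  show "area v w = 0" for v
    using rotation_eq_area[OF base_in_chart[OF y], of w v] assms curved[OF y]
    by (simp add: expand[OF base_in_chart[OF y]])
qed

lemma covariant_derivative_vertical_normal:
  assumes y: "y \<in> U"
  shows "D q y E = (area (X E y) (p y) / 2) *\<^sub>R \<R> (\<pi> y) (\<xi> y)"
  using vertical_normal_derivative[OF y] curvature_eq_rotation[OF base_in_chart[OF y]] by simp

lemma has_derivative_vertical_normal:
  assumes y: "y \<in> U"
  shows "(q has_derivative (\<lambda>E. (area (X E y) (p y) / 2) *\<^sub>R \<R> (\<pi> y) (\<xi> y) - \<Gamma> (\<pi> y) (X E y) (q y))) (at y)"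
proof -
  have "frechet_derivative q (at y) E = (area (X E y) (p y) / 2) *\<^sub>R \<R> (\<pi> y) (\<xi> y) - \<Gamma> (\<pi> y) (X E y) (q y)" for E
    using covariant_derivative_vertical_normal[OF y, of E]
      covariant_derivative_eq[OF has_derivative_base[OF differentiable_map[OF y]]
          differentiable_vertical_normal[OF y, unfolded frechet_derivative_works], of E]
    by (simp add: algebra_simps)
  then show ?thesis
    using differentiable_vertical_normal[OF y, unfolded frechet_derivative_works] by presburger
qed

lemma horizontal_vector_ex:
  assumes y: "y \<in> U" and q: "q y \<noteq> 0"
  obtains E where "X E y = v"
proof -
  note V = base_in_chart[OF y]
  have "g c (\<pi> y) v (p y) + g c (\<pi> y) (- (g c (\<pi> y) v (p y) / g c (\<pi> y) (q y) (q y)) *\<^sub>R q y) (q y) = 0"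
    using positive[OF V q] by (simp add: expand[OF V])
  then obtain E where "X E y = v" by (rule tangent_vector_ex[OF y])
  then show ?thesis by (rule that)
qed

text \<open>Where q does not vanish, the hypersurface cuts the fibre in a curve; let E0 be a parameter direction
tangent to that curve. There the base point is stationary, so the mixed second derivatives of q in
the directions E0 and E involve no derivative of the coefficients along E0. Comparing the two orders
of differentiation gives the identity \<open>key\<close>. Paired with the tangent of the curve it
forces the derivative of p along E0 to vanish, unless the fibre point is parallel to that
tangent and hence orthogonal to q; and the equation for this derivative of p then forces p to vanish.\<close>

lemma horizontal_normal_or_orthogonal_fibre:
  assumes y: "y \<in> U" and q: "q y \<noteq> 0"
  shows "p y = 0 \<or> g c (\<pi> y) (\<xi> y) (q y) = 0"
proof (rule ccontr)
  assume neg: "\<not> ?thesis"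
  note V = base_in_chart[OF y]
  obtain \<zeta> where \<zeta>: "\<zeta> \<noteq> 0" "g c (\<pi> y) \<zeta> (q y) = 0"
    using orthogonal_vector_ex[OF V q] .
  have "g c (\<pi> y) 0 (p y) + g c (\<pi> y) \<zeta> (q y) = 0"
    using \<zeta> by (simp add: expand[OF V])
  then obtain E0 where E0: "X E0 y = 0" "Z E0 y = \<zeta>"
    by (rule tangent_vector_ex[OF y])
  have pair: "g c (\<pi> y) (\<R> (\<pi> y) (\<xi> y)) \<zeta> \<noteq> 0"
  proof
    assume "g c (\<pi> y) (\<R> (\<pi> y) (\<xi> y)) \<zeta> = 0"
    then have "area \<zeta> (\<xi> y) = 0" using rotation_eq_area[OF V] curved[OF y] by simp
    then obtain t where "\<xi> y = t *\<^sub>R \<zeta>" using parallel_if_area_zero \<zeta>(1) by blast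
    then show False using neg \<zeta>(2) by (simp add: expand[OF V])
  qed
  define p' where "p' = frechet_derivative p (at y)"
  define q' where "q' = (\<lambda>z E. (area (X E z) (p z) / 2) *\<^sub>R \<R> (\<pi> z) (\<xi> z) - \<Gamma> (\<pi> z) (X E z) (q z))"
  define h where "h = (\<lambda>E F. base_part (frechet_derivative (\<lambda>y. frechet_derivative f (at y) E) (at y) F))"
  have p': "(p has_derivative p') (at y)"
    using differentiable_horizontal_normal[OF y] unfolding p'_def frechet_derivative_works .
  have q': "(q has_derivative q' z) (at z)" if "z \<in> U" for z
    unfolding q'_def by (rule has_derivative_vertical_normal[OF that])
  have X': "(X E has_derivative h E) (at y)" for E
    unfolding h_def by (rule has_derivative_horizontal[OF y])
  have h_sym: "h E F = h F E" for E F
    unfolding h_def by (rule arg_cong[OF second_velocity_symmetric[OF y]])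
  let ?\<xi>' = "\<lambda>F. Z F y - \<Gamma> (\<pi> y) (X F y) (\<xi> y)"
  \<comment> \<open>the derivative of the rotated fibre point; with its second argument fixed, the curvature is a
    bilinear field, here evaluated at a constant vector and the fibre point\<close>
  let ?\<R>' = "\<lambda>F. field_derivative (\<lambda>x u w. curvature x u (axis 2 1) w) (\<pi> y) (X F y) (axis 1 1) (\<xi> y)
    + curvature (\<pi> y) 0 (axis 2 1) (\<xi> y) + \<R> (\<pi> y) (?\<xi>' F)"
  have rot: "((\<lambda>z. \<R> (\<pi> z) (\<xi> z)) has_derivative ?\<R>') (at y)"
    unfolding rotation_def
    by (rule curvature.has_derivative[OF V has_derivative_base[OF differentiable_map[OF y]]
          has_derivative_const has_derivative_fibre[OF differentiable_map[OF y] V]])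
  have ar: "((\<lambda>z. area (X E z) (p z) / 2) has_derivative (\<lambda>F. (area (X E y) (p' F) + area (h E F) (p y)) / 2)) (at y)" for E
    using bounded_bilinear.FDERIV[OF bounded_bilinear_area X' p', of E]
    by (auto intro!: derivative_eq_intros)
  define L where "L = (\<lambda>E F. (area (X E y) (p y) / 2) *\<^sub>R ?\<R>' F
      + ((area (X E y) (p' F) + area (h E F) (p y)) / 2) *\<^sub>R \<R> (\<pi> y) (\<xi> y)
      - (d\<Gamma> (\<pi> y) (X F y) (X E y) (q y) + \<Gamma> (\<pi> y) (h E F) (q y) + \<Gamma> (\<pi> y) (X E y) (q' y F)))"
  have L: "((\<lambda>z. q' z E) has_derivative L E) (at y)" for E
  proof -
    have "(q has_derivative (\<lambda>E. q' y E)) (at y)" using q'[OF y] by simp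
    from has_derivative_diff[OF has_derivative_scaleR[OF ar rot]
        christoffel.has_derivative[OF V has_derivative_base[OF differentiable_map[OF y]] X' this], of E]
    show ?thesis unfolding L_def q'_def .
  qed
  have q'0: "q' y E0 = 0"
    by (simp add: q'_def E0 christoffel_expand)
  have key: "area (X E y) (p' E0) *\<^sub>R \<R> (\<pi> y) (\<xi> y) + area (X E y) (p y) *\<^sub>R \<R> (\<pi> y) \<zeta> = 0" for E
  proof -
    have "L E E0 = L E0 E"
      by (rule second_derivative_symmetric[where f = q and f' = q', OF open_parameters y q' L L])
    \<comment> \<open>the terms containing the horizontal velocity of E0 or the derivative of q along E0 vanish\<close>
    moreover have "L E E0 = (area (X E y) (p y) / 2) *\<^sub>R \<R> (\<pi> y) \<zeta>
      + ((area (X E y) (p' E0) + area (h E0 E) (p y)) / 2) *\<^sub>R \<R> (\<pi> y) (\<xi> y) - \<Gamma> (\<pi> y) (h E0 E) (q y)"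
      unfolding L_def h_sym[of E E0]
      by (simp add: E0 q'0 christoffel_expand linear_0[OF christoffel.linear_direction[OF V]]
          linear_0[OF curvature.linear_direction[OF V]] bilinear_lzero[OF curvature.bilinear[OF V]])
    moreover have "L E0 E = (area (h E0 E) (p y) / 2) *\<^sub>R \<R> (\<pi> y) (\<xi> y) - \<Gamma> (\<pi> y) (h E0 E) (q y)"
      unfolding L_def
      by (simp add: E0 christoffel_expand bilinear_lzero[OF christoffel.bilinear_field_derivative[OF V]])
    ultimately have "(1 / 2) *\<^sub>R (area (X E y) (p y) *\<^sub>R \<R> (\<pi> y) \<zeta> + area (X E y) (p' E0) *\<^sub>R \<R> (\<pi> y) (\<xi> y)) = 0"
      by (simp add: add_divide_distrib scaleR_add_left scaleR_add_right)
    then show ?thesis by (simp add: add.commute)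
  qed
  have "p' E0 = 0"
  proof (rule eq_zero_if_area_zero)
    fix v
    obtain E where E: "X E y = v" using horizontal_vector_ex[OF y q] .
    have "g c (\<pi> y) (area v (p' E0) *\<^sub>R \<R> (\<pi> y) (\<xi> y) + area v (p y) *\<^sub>R \<R> (\<pi> y) \<zeta>) \<zeta> = 0"
      using key[of E] by (simp add: E expand[OF V])
    moreover have "g c (\<pi> y) (\<R> (\<pi> y) \<zeta>) \<zeta> = 0"
      using rotation_eq_area[OF V, of \<zeta> \<zeta>] by (simp add: area_def)
    ultimately show "area v (p' E0) = 0"
      using pair by (simp add: expand[OF V])
  qed
  moreover have "D p y E0 = p' E0"
    using covariant_derivative_eq[OF has_derivative_base[OF differentiable_map[OF y]] p', of E0]
    by (simp add: E0 christoffel_expand)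
  ultimately have "g c (\<pi> y) \<zeta> (curvature (\<pi> y) u (p y) (\<xi> y)) = 0" for u
    using horizontal_normal_derivative[OF y, of u E0]
    by (simp add: E0 expand[OF V] bilinear_expand[OF bilinear_curvature[OF V]])
  \<comment> \<open>the derivative of p in the direction E0 vanishes, so its equation reads 0 = area u p times a nonzero number\<close>
  then have "area u (p y) = 0" for u
    using pair symmetric[OF V, of \<zeta> "\<R> (\<pi> y) (\<xi> y)"] by (simp add: curvature_eq_rotation[OF V] expand[OF V])
  then have "p y = 0" by (rule eq_zero_if_area_zero)
  then show False using neg by simp
qed

lemma continuous_normal:
  "continuous_on U p" "continuous_on U q"
  using differentiable_horizontal_normal differentiable_vertical_normal
  by (auto intro!: differentiable_imp_continuous_on differentiable_at_imp_differentiable_on)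

text \<open>If p did not vanish, the fibre point would be orthogonal to q on an open set. Differentiating this
relation, where the derivative of q contributes nothing because the rotation is skew, shows that
all vertical velocities are orthogonal to q. Then all horizontal velocities are orthogonal to p,
although they exhaust the tangent plane.\<close>

lemma horizontal_normal_zero:
  assumes y: "y \<in> U" and q: "q y \<noteq> 0"
  shows "p y = 0"
proof (rule ccontr)
  assume p: "p y \<noteq> 0"
  define W where "W = {z \<in> U. p z \<noteq> 0} \<inter> {z \<in> U. q z \<noteq> 0}"
  have W: "open W" "y \<in> W"
    using open_nonvanishing[OF open_parameters] continuous_normal y p q by (auto simp: W_def)
  have zero: "g c (\<pi> z) (\<xi> z) (q z) = 0" if "z \<in> W" for z
    using horizontal_normal_or_orthogonal_fibre[of z] that by (auto simp: W_def)
  note V = base_in_chart[OF y]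
  have d: "((\<lambda>y. g c (\<pi> y) (\<xi> y) (q y)) has_derivative
    (\<lambda>E. g c (\<pi> y) (D \<xi> y E) (q y) + g c (\<pi> y) (\<xi> y) (D q y E))) (at y)"
    by (rule has_derivative_metric_along[where x = \<pi>, OF V differentiable_base[OF y]
          differentiableI[OF has_derivative_fibre[OF differentiable_map[OF y] V]] differentiable_vertical_normal[OF y]])
  have "((\<lambda>y. g c (\<pi> y) (\<xi> y) (q y)) has_derivative (\<lambda>E. 0)) (at y)"
    by (rule has_derivative_transform_within_open[OF has_derivative_const W]) (simp add: zero)
  from fun_cong[OF has_derivative_unique[OF d this]]
  have *: "g c (\<pi> y) (D \<xi> y E) (q y) + g c (\<pi> y) (\<xi> y) (D q y E) = 0" for E
    by simp
  have "g c (\<pi> y) (\<xi> y) (\<R> (\<pi> y) (\<xi> y)) = 0"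
    using rotation_eq_area[OF V, of "\<xi> y" "\<xi> y"] symmetric[OF V, of "\<xi> y"] by (simp add: area_def)
  then have "g c (\<pi> y) (Z E y) (q y) = 0" for E
    using *[of E] covariant_derivative_fibre[OF differentiable_map[OF y] V, of E]
    by (simp add: covariant_derivative_vertical_normal[OF y] expand[OF V])
  then have tangential: "g c (\<pi> y) (X E y) (p y) = 0" for E
    using orthogonal[OF y, of E] by simp
  obtain E where "X E y = p y" using horizontal_vector_ex[OF y q] .
  then show False
    using tangential[of E] positive[OF V p] by simp
qed

text \<open>With p = 0 the equation for q says that q is parallel along the hypersurface. Horizontal velocities fill
the tangent plane, so the curvature annihilates q, which is impossible for q nonzero.\<close>

lemma vertical_normal_zero:
  assumes y: "y \<in> U"
  shows "q y = 0"
proof (rule ccontr)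
  assume q: "q y \<noteq> 0"
  define W where "W = {z \<in> U. q z \<noteq> 0}"
  have "open W"
    unfolding W_def by (rule open_nonvanishing[OF open_parameters continuous_normal(2)])
  note V = base_in_chart[OF y]
  obtain E where E: "X E y = axis 1 1" using horizontal_vector_ex[OF y q] .
  obtain F where F: "X F y = axis 2 1" using horizontal_vector_ex[OF y q] .
  have "curvature (\<pi> y) (X E y) (X F y) (q y) = 0"
  proof (rule parallel_vertical_normal_curvature[OF \<open>open W\<close>])
    show "W \<subseteq> U" "y \<in> W" using y q by (auto simp: W_def)
    show "D q z G = 0" if "z \<in> W" for z G
      using that covariant_derivative_vertical_normal[of z G] horizontal_normal_zero[of z]
      by (simp add: W_def)
  qed
  then have "\<R> (\<pi> y) (q y) = 0" by (simp add: E F rotation_def)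
  then show False using rotation_injective[OF y] q by blast
qed

text \<open>With q = 0 throughout, the equation for q forces the fibre point to vanish, so the image lies in the zero
section, which is too small to contain a hypersurface.\<close>

lemma no_parameters: "U = {}"
proof (rule ccontr)
  assume "U \<noteq> {}"
  have fibre_zero: "\<xi> y = 0" if y: "y \<in> U" for y
  proof -
    note V = base_in_chart[OF y]
    have "p y \<noteq> 0"
      using unit[OF y] vertical_normal_zero[OF y] by (auto simp: expand[OF V])
    then obtain u where u: "area u (p y) \<noteq> 0" using eq_zero_if_area_zero by blast
    obtain E t where E: "u = X E y + t *\<^sub>R p y" using spanning[OF y] by blast
    have "area (X E y) (p y) \<noteq> 0"
      using u unfolding E by (simp add: area_def algebra_simps)
    moreover have "D q y E = 0"
    proof -
      have "(q has_derivative (\<lambda>E. 0)) (at y)"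
        by (rule has_derivative_transform_within_open[OF has_derivative_const open_parameters y])
          (simp add: vertical_normal_zero)
      from covariant_derivative_eq[OF has_derivative_base[OF differentiable_map[OF y]] this]
      show ?thesis by (simp add: vertical_normal_zero[OF y] christoffel_expand)
    qed
    ultimately have "\<R> (\<pi> y) (\<xi> y) = 0"
      using covariant_derivative_vertical_normal[OF y, of E] by simp
    then show ?thesis by (rule rotation_injective[OF y])
  qed
  obtain y where y: "y \<in> U" using \<open>U \<noteq> {}\<close> by blast
  note V = base_in_chart[OF y]
  have "(\<xi> has_derivative (\<lambda>E. 0)) (at y)"
    by (rule has_derivative_transform_within_open[OF has_derivative_const open_parameters y])
      (simp add: fibre_zero)
  from covariant_derivative_eq[OF has_derivative_base[OF differentiable_map[OF y]] this]
  have "Z E y = 0" for E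
    using covariant_derivative_fibre[OF differentiable_map[OF y] V, of E]
    by (simp add: fibre_zero[OF y] christoffel_expand)
  then have "w = 0" for w :: "real^2"
    using spanning[OF y, of 0 w] vertical_normal_zero[OF y] by auto
  from this[of "axis 1 1"] show False by (simp add: axis_eq_0_iff)
qed

end

section \<open>Local unit normal fields\<close>

lemma differentiable_prod:
  fixes f :: "'i \<Rightarrow> 'a::real_normed_vector \<Rightarrow> real"
  assumes "\<And>i. i \<in> I \<Longrightarrow> f i differentiable (at x)"
  shows "(\<lambda>x. \<Prod>i\<in>I. f i x) differentiable (at x)"
  using assms by (induction I rule: infinite_finite_induct) auto

lemma differentiable_det:
  fixes A :: "'a::real_normed_vector \<Rightarrow> real^'n^'n"
  assumes "\<And>i j. (\<lambda>x. A x $ i $ j) differentiable (at x)"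
  shows "(\<lambda>x. det (A x)) differentiable (at x)"
  unfolding det_def
  by (intro differentiable_sum ballI differentiable_mult differentiable_const differentiable_prod assms)
    (simp add: finite_permutations)

lemma differentiable_matrix_inv:
  fixes A :: "'a::real_normed_vector \<Rightarrow> real^'n^'n"
  assumes "open S" "x \<in> S" "\<And>i j. (\<lambda>x. A x $ i $ j) differentiable (at x)"
    and "\<And>x. x \<in> S \<Longrightarrow> invertible (A x)"
  shows "(\<lambda>x. matrix_inv (A x) $ a $ b) differentiable (at x)"
proof -
  have entry: "(\<lambda>x. (\<chi> i j. if j = a then axis b 1 $ i else A x $ i $ j) $ i $ j) differentiable (at x)" for i j
    using assms(3) by (cases "j = a") auto
  have "(\<lambda>x. det (\<chi> i j. if j = a then axis b 1 $ i else A x $ i $ j) * inverse (det (A x))) differentiable (at x)"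
    using assms(2,4)
    by (intro differentiable_mult differentiable_inverse differentiable_det assms(3) entry)
      (auto simp: invertible_det_nz)
  then obtain D where "((\<lambda>x. det (\<chi> i j. if j = a then axis b 1 $ i else A x $ i $ j) * inverse (det (A x)))
    has_derivative D) (at x)"
    unfolding differentiable_def by blast
  then have "((\<lambda>x. matrix_inv (A x) $ a $ b) has_derivative D) (at x)"
    by (rule has_derivative_transform_within_open[OF _ assms(1,2)])
      (simp add: matrix_inv_entry_cramer[OF assms(4)])
  then show ?thesis by (rule differentiableI)
qed

context metric_on_chart
begin

text \<open>A fixed vector outside the tangent space at y0, minus its orthogonal projection to the tangent spaces, is
a normal field that does not vanish near y0. The coefficients of the projection solve a linear system
with the Gram matrix of the velocities, which is invertible as they are independent.\<close>

lemma unit_normal_field_ex: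
  fixes f :: "real^'k \<Rightarrow> real^'n"
  assumes U: "open U" "y0 \<in> U" and fV: "\<And>y. y \<in> U \<Longrightarrow> f y \<in> V"
    and f: "\<And>y. y \<in> U \<Longrightarrow> f differentiable (at y)"
    and f': "\<And>y E. y \<in> U \<Longrightarrow> (\<lambda>y. frechet_derivative f (at y) E) differentiable (at y)"
    and inj: "\<And>y. y \<in> U \<Longrightarrow> inj (frechet_derivative f (at y))"
    and card: "CARD('k) < CARD('n)"
  obtains U' N where "open U'" "y0 \<in> U'" "U' \<subseteq> U" "\<And>y. y \<in> U' \<Longrightarrow> N differentiable (at y)"
    "\<And>y E. y \<in> U' \<Longrightarrow> g c (f y) (frechet_derivative f (at y) E) (N y) = 0"
    "\<And>y. y \<in> U' \<Longrightarrow> g c (f y) (N y) (N y) = 1"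
proof -
  let ?F = "\<lambda>y. frechet_derivative f (at y)"
  let ?e = "\<lambda>i. axis i (1::real)"
  have lin: "linear (?F y)" if "y \<in> U" for y
    using f[OF that] by (rule linear_frechet_derivative)
  have diff: "(\<lambda>y. g c (f y) (u y) (w y)) differentiable (at y)"
    if "y \<in> U" "u differentiable (at y)" "w differentiable (at y)" for u w y
    using has_derivative[OF fV[OF that(1)] f[OF that(1), unfolded frechet_derivative_works]
        that(2)[unfolded frechet_derivative_works] that(3)[unfolded frechet_derivative_works]]
    by (rule differentiableI)
  have "range (?F y0) \<noteq> UNIV"
  proof
    assume "range (?F y0) = UNIV"
    then have "dim (UNIV :: (real^'n) set) \<le> dim (UNIV :: (real^'k) set)"
      using dim_image_le[OF lin[OF U(2)], of UNIV] by simp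
    then show False using card by simp
  qed
  then obtain w where w: "w \<notin> range (?F y0)" by blast
  define Gram where "Gram = (\<lambda>y. \<chi> i j. g c (f y) (?F y (?e i)) (?F y (?e j)))"
  define \<alpha> where "\<alpha> = (\<lambda>y. matrix_inv (Gram y) *v (\<chi> j. g c (f y) (?F y (?e j)) w))"
  define n where "n = (\<lambda>y. w - ?F y (\<alpha> y))"
  have Gram_apply: "(Gram y *v d) $ i = g c (f y) (?F y (?e i)) (?F y d)" if y: "y \<in> U" for y d i
  proof -
    have "linear (\<lambda>d. g c (f y) (?F y (?e i)) (?F y d))"
      using linear_compose[OF lin[OF y], of "g c (f y) (?F y (?e i))"] bilinear[OF fV[OF y]]
      by (simp add: bilinear_def o_def)
    from linear_axis_expansion[OF this, of d] show ?thesis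
      by (simp add: Gram_def matrix_vector_mult_def mult.commute)
  qed
  have invertible: "invertible (Gram y)" if y: "y \<in> U" for y
  proof -
    have "d = 0" if "Gram y *v d = 0" for d
    proof -
      have "linear (\<lambda>u. g c (f y) (?F y u) (?F y d))"
        using linear_compose[OF lin[OF y], of "\<lambda>u. g c (f y) u (?F y d)"] bilinear[OF fV[OF y]]
        by (simp add: bilinear_def o_def)
      from linear_axis_expansion[OF this, of d] have "g c (f y) (?F y d) (?F y d) = 0"
        using Gram_apply[OF y, of d] that by simp
      then have "?F y d = 0" using positive[OF fV[OF y], of "?F y d"] by force
      then show ?thesis
        using inj[OF y] lin[OF y] linear_injective_0 by blast
    qed
    then show ?thesis
      unfolding invertible_left_inverse matrix_left_invertible_ker by blast
  qed
  have orth_axis: "g c (f y) (?F y (?e i)) (n y) = 0" if y: "y \<in> U" for y i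
  proof -
    have "Gram y *v \<alpha> y = (\<chi> j. g c (f y) (?F y (?e j)) w)"
      using matrix_mul_matrix_inv[OF invertible[OF y]] by (simp add: \<alpha>_def matrix_vector_mul_assoc)
    then have "g c (f y) (?F y (?e i)) (?F y (\<alpha> y)) = g c (f y) (?F y (?e i)) w"
      using Gram_apply[OF y, of "\<alpha> y" i] by simp
    then show ?thesis by (simp add: n_def expand[OF fV[OF y]])
  qed
  have orth: "g c (f y) (?F y E) (n y) = 0" if y: "y \<in> U" for y E
  proof -
    have "linear (\<lambda>u. g c (f y) (?F y u) (n y))"
      using linear_compose[OF lin[OF y], of "\<lambda>u. g c (f y) u (n y)"] bilinear[OF fV[OF y]]
      by (simp add: bilinear_def o_def)
    from linear_axis_expansion[OF this, of E] show ?thesis by (simp add: orth_axis[OF y])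
  qed
  have dn: "n differentiable (at y)" if y: "y \<in> U" for y
  proof -
    have inv: "(\<lambda>y. matrix_inv (Gram y) $ i $ j) differentiable (at y)" for i j
      by (rule differentiable_matrix_inv[OF U(1) y _ invertible])
        (simp_all add: Gram_def diff[OF y f'[OF y] f'[OF y]])
    have \<alpha>: "(\<lambda>y. \<alpha> y $ i) differentiable (at y)" for i
      unfolding \<alpha>_def matrix_vector_mult_def
      by (simp, intro differentiable_sum ballI differentiable_mult inv diff[OF y f'[OF y]]) auto
    have "(\<lambda>y. w - (\<Sum>i\<in>UNIV. \<alpha> y $ i *\<^sub>R ?F y (?e i))) differentiable (at y)"
      by (intro differentiable_diff differentiable_const differentiable_sum ballI differentiable_scaleR \<alpha> f'[OF y]) auto
    then obtain D where "((\<lambda>y. w - (\<Sum>i\<in>UNIV. \<alpha> y $ i *\<^sub>R ?F y (?e i))) has_derivative D) (at y)"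
      unfolding differentiable_def by blast
    then have "(n has_derivative D) (at y)"
      by (rule has_derivative_transform_within_open[OF _ U(1) y])
        (simp add: n_def flip: linear_axis_expansion[OF lin])
    then show ?thesis by (rule differentiableI)
  qed
  have n0: "n y0 \<noteq> 0" using w by (auto simp: n_def)
  define U' where "U' = {y \<in> U. n y \<noteq> 0}"
  define N where "N = (\<lambda>y. inverse (sqrt (g c (f y) (n y) (n y))) *\<^sub>R n y)"
  show ?thesis
  proof (rule that)
    have "continuous_on U n"
      using dn by (auto intro!: differentiable_imp_continuous_on differentiable_at_imp_differentiable_on)
    then show "open U'" unfolding U'_def by (rule open_nonvanishing[OF U(1)])
    show "y0 \<in> U'" "U' \<subseteq> U" using U n0 by (auto simp: U'_def)
    fix y assume "y \<in> U'"
    then have y: "y \<in> U" "n y \<noteq> 0" by (auto simp: U'_def)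
    have pos: "g c (f y) (n y) (n y) > 0" using positive[OF fV[OF y(1)] y(2)] .
    obtain D where D: "((\<lambda>y. g c (f y) (n y) (n y)) has_derivative D) (at y)"
      using diff[OF y(1) dn[OF y(1)] dn[OF y(1)]] unfolding differentiable_def by blast
    have "((\<lambda>y. sqrt (g c (f y) (n y) (n y))) has_derivative (\<lambda>h. D h * (inverse (sqrt (g c (f y) (n y) (n y))) / 2))) (at y)"
      using has_derivative_real_sqrt[OF pos D] .
    then have "(\<lambda>y. sqrt (g c (f y) (n y) (n y))) differentiable (at y)" by (rule differentiableI)
    then show "N differentiable (at y)"
      unfolding N_def using pos dn[OF y(1)]
      by (intro differentiable_scaleR differentiable_inverse) auto
    show "g c (f y) (?F y E) (N y) = 0" for E
      by (simp add: N_def expand[OF fV[OF y(1)]] orth[OF y(1)])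
    have "sqrt (g c (f y) (n y) (n y)) * sqrt (g c (f y) (n y) (n y)) = g c (f y) (n y) (n y)"
      using pos by simp
    then show "g c (f y) (N y) (N y) = 1"
      using pos by (simp add: N_def expand[OF fV[OF y(1)]] field_simps)
  qed
qed

lemma unit_normal_spanning:
  fixes \<phi> :: "real^'k \<Rightarrow> real^'n"
  assumes x: "x \<in> V" and \<phi>: "linear \<phi>" "inj \<phi>" and card: "CARD('n) = CARD('k) + 1"
    and orth: "\<And>E. g c x (\<phi> E) N = 0" and unit: "g c x N N = 1"
  shows "\<exists>E t. v = \<phi> E + t *\<^sub>R N"
proof -
  define \<psi> where "\<psi> = (\<lambda>s::(real^'k) \<times> real. \<phi> (fst s) + snd s *\<^sub>R N)"
  have lin: "linear \<psi>"
    unfolding \<psi>_def by (rule linearI) (simp_all add: linear_add[OF \<phi>(1)] linear_cmul[OF \<phi>(1)] algebra_simps)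
  have "inj \<psi>"
    unfolding linear_injective_0[OF lin]
  proof (intro allI impI)
    fix s assume s: "\<psi> s = 0"
    have "snd s = g c x (\<psi> s) N"
      by (simp add: \<psi>_def expand[OF x] orth unit)
    then have "snd s = 0" using s by (simp add: expand[OF x])
    moreover from this have "\<phi> (fst s) = 0" using s by (simp add: \<psi>_def)
    then have "fst s = 0" using \<phi> linear_injective_0 by blast
    ultimately show "s = 0" by (simp add: prod_eq_iff)
  qed
  then have "dim (range \<psi>) = dim (UNIV :: ((real^'k) \<times> real) set)"
    using dim_image_eq[OF lin, of UNIV] by simp
  also have "\<dots> = DIM(real^'n)" using card by simp
  finally have "range \<psi> = UNIV"
    using dim_eq_full[of "range \<psi>"] linear_subspace_image[OF lin subspace_UNIV]
    by (metis span_eq_iff)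
  then obtain s where "v = \<psi> s" by blast
  then show ?thesis unfolding \<psi>_def by blast
qed

text \<open>The second fundamental form is bilinear, so its vanishing on coordinate directions extends to all
directions. Linearity in Q holds because Q and P can be exchanged in the second derivative.\<close>

lemma second_fundamental_form_directions:
  fixes f :: "real^'k \<Rightarrow> real^'n"
  assumes U: "open U" "y \<in> U" and fV: "f y \<in> V"
    and f: "\<And>y. y \<in> U \<Longrightarrow> f differentiable (at y)"
    and f': "\<And>E. (\<lambda>y. frechet_derivative f (at y) E) differentiable (at y)"
    and axes: "\<And>i j. g c (f y) (partial i (partial j f) y
      + christoffel_map g c (f y) (partial i f y) (partial j f y)) N = 0"
  shows "g c (f y) (frechet_derivative (\<lambda>y. frechet_derivative f (at y) Q) (at y) P
      + christoffel_map g c (f y) (frechet_derivative f (at y) P) (frechet_derivative f (at y) Q)) N = 0"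
proof -
  let ?F = "frechet_derivative f (at y)"
  let ?h = "\<lambda>P Q. frechet_derivative (\<lambda>y. frechet_derivative f (at y) Q) (at y) P"
  let ?B = "\<lambda>P Q. g c (f y) (?h P Q + christoffel_map g c (f y) (?F P) (?F Q)) N"
  have sym: "?h P Q = ?h Q P" for P Q
    by (rule second_derivative_symmetric[where f = f and f' = "\<lambda>y. frechet_derivative f (at y)", OF U])
      (use f f' in \<open>simp_all flip: frechet_derivative_works\<close>)
  have lin1: "linear (\<lambda>P. ?h P Q)" for Q
    using f' by (rule linear_frechet_derivative)
  have lin2: "linear (\<lambda>Q. ?h P Q)" for P
    using lin1[of P] sym[of _ P] by simp
  have linF: "linear ?F" using f[OF U(2)] by (rule linear_frechet_derivative)
  note lins = linear_add[OF linF] linear_cmul[OF linF] linear_add[OF lin1] linear_cmul[OF lin1]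
    linear_add[OF lin2] linear_cmul[OF lin2]
  have B: "bilinear ?B"
    unfolding bilinear_def
    by (intro conjI allI linearI)
      (simp_all only: lins expand[OF fV] bilinear_expand[OF bilinear_christoffel_map], simp_all add: algebra_simps)
  have "?B (axis i 1) (axis j 1) = 0" for i j
    using axes[of i j] by (simp add: partial_def[abs_def])
  then show ?thesis
    using bilinear_axis_expansion[OF B, where u = P and w = Q] by simp
qed

end

section \<open>Hypersurfaces of the tangent bundle of a surface\<close>

lemma (in smooth_metric_on_chart) riemann_curvature_eq_curvature:
  assumes x: "x \<in> V"
  shows "riemann_curvature g c i j k x = curvature x (axis i 1) (axis j 1) (axis k 1)"
proof -
  have single: "christoffel_map g c x (axis a 1) (axis b 1) $ l = christoffel g c l a b x" for a b l x
  proof -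
    have "christoffel g c l m n x * axis a 1 $ m * axis b 1 $ n =
        (if n = b then if m = a then christoffel g c l a b x else 0 else 0)" for m n
      by (simp add: axis_def)
    then show ?thesis by (simp add: christoffel_map_def)
  qed
  have d: "d\<Gamma> x a (axis m 1) (axis n 1) $ l = frechet_derivative (\<lambda>x. christoffel g c l m n x) (at x) a" for a m n l
  proof -
    have "((\<lambda>z. \<Gamma> z (axis m 1) (axis n 1) $ l) has_derivative (\<lambda>a. d\<Gamma> x a (axis m 1) (axis n 1) $ l)) (at x)"
      by (rule bounded_linear.has_derivative[OF bounded_linear_vec_nth christoffel.has_derivative_fixed[OF x]])
    then show ?thesis
      unfolding single by (metis frechet_derivative_at)
  qed
  have lin: "linear (\<Gamma> x a)" for a
    using bilinear_christoffel_map[of g c x] by (simp add: bilinear_def)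
  have comp: "\<Gamma> x (axis a 1) v $ l = (\<Sum>m\<in>UNIV. v $ m * christoffel g c l a m x)" for a v l
    by (subst linear_axis_expansion[OF lin]) (simp add: single)
  show ?thesis
    by (simp add: vec_eq_iff riemann_curvature_def curvature_def d comp single partial_def sum_subtractf)
qed

lemma smooth_metric_on_chart_image:
  assumes "smooth_manifold M" "riemannian_metric M g" "c \<in> M"
  shows "smooth_metric_on_chart g c (chart_image c)"
proof
  show "open (chart_image c)" using assms(1,3) by (auto simp: smooth_manifold_def)
  show "bilinear (g c x)" if "x \<in> chart_image c" for x
    using assms(2,3) that by (auto simp: riemannian_metric_def)
  show sm: "smooth_on (chart_image c) (\<lambda>x. g c x u w)" for u w
    using assms(2,3) by (auto simp: riemannian_metric_def)
  show "(\<lambda>x. g c x u w) differentiable (at x)" if "x \<in> chart_image c" for x u w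
    using sm[of u w] that C_k_on_imp_differentiable[of 0] unfolding smooth_on_def by blast
  show "g c x u w = g c x w u" if "x \<in> chart_image c" for x u w
    using assms(2,3) that by (auto simp: riemannian_metric_def)
  show "g c x u u > 0" if "x \<in> chart_image c" "u \<noteq> 0" for x u
    using assms(2,3) that by (auto simp: riemannian_metric_def)
qed

lemma transition_tangent_chart_base:
  assumes "inj_on (snd b) (fst b)" "y \<in> snd b ` (fst b \<inter> fst (tangent_chart M c))"
  shows "base_part (transition b (tangent_chart M c) y) \<in> chart_image c"
proof -
  obtain P where P: "P \<in> fst b" "P \<in> fst (tangent_chart M c)" "y = snd b P" using assms(2) by blast
  then have "chart_inv b y = P" using assms(1) by (simp add: chart_inv_def)
  then have "base_part (transition b (tangent_chart M c) y) = snd c (fst P)"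
    by (simp add: transition_def tangent_chart_def base_part_def vec_eq_iff split: prod.splits)
  moreover have "fst P \<in> fst c" using P(2) by (auto simp: tangent_chart_def)
  ultimately show ?thesis by (simp add: chart_image_def)
qed

lemma transition_tangent_chart_base_at:
  assumes "inj_on (snd b) (fst b)" "P \<in> fst b"
  shows "base_part (transition b (tangent_chart M c) (snd b P)) = snd c (fst P)"
  using assms
  by (simp add: chart_inv_def transition_def tangent_chart_def base_part_def vec_eq_iff split: prod.splits)

theorem theorem3:
  fixes M :: "('p, 2) chart set" and g :: "('p, 2) metric_field"
  assumes "smooth_manifold M"
    and "riemannian_metric M g"
    and "sign_preserving_curvature M g"
  shows "\<not> (\<exists>(W :: ('p, 2) tangent_point set) (N :: (('p, 2) tangent_point, 3) chart set).
            openin (atlas_topology (tangent_atlas M)) W \<and> carrier N \<subseteq> W \<and> carrier N \<noteq> {} \<and>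
            submanifold (tangent_atlas M) N \<and>
            totally_geodesic (tangent_atlas M) (sasaki_metric M g) N)"
proof
  assume "\<exists>(W :: ('p, 2) tangent_point set) (N :: (('p, 2) tangent_point, 3) chart set).
            openin (atlas_topology (tangent_atlas M)) W \<and> carrier N \<subseteq> W \<and> carrier N \<noteq> {} \<and>
            submanifold (tangent_atlas M) N \<and>
            totally_geodesic (tangent_atlas M) (sasaki_metric M g) N"
  then obtain N :: "(('p, 2) tangent_point, 3) chart set" where
    nonempty: "carrier N \<noteq> {}" and sub: "submanifold (tangent_atlas M) N"
    and tg: "totally_geodesic (tangent_atlas M) (sasaki_metric M g) N" by blast
  obtain b P where b: "b \<in> N" and P: "P \<in> fst b" using nonempty by (auto simp: carrier_def)
  have "P \<in> carrier (tangent_atlas M)" using sub b P by (auto simp: submanifold_def carrier_def)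
  then have PT: "P \<in> tangent_bundle M" by (auto simp: carrier_def tangent_atlas_def tangent_chart_def)
  then have Pc: "fst P \<in> carrier M" by (auto simp: tangent_bundle_def)
  \<comment> \<open>this is the chart in which the Gaussian curvature at the foot point of P is computed; near P
    its curvature stays nonzero by continuity\<close>
  define c where "c = (SOME c. c \<in> M \<and> fst P \<in> fst c)"
  have "c \<in> M \<and> fst P \<in> fst c"
    unfolding c_def by (rule someI_ex) (use Pc in \<open>unfold carrier_def, blast\<close>)
  then have c: "c \<in> M" "fst P \<in> fst c" by blast+
  define C where "C = tangent_chart M c"
  have C: "C \<in> tangent_atlas M" using c by (simp add: C_def tangent_atlas_def)
  have PC: "P \<in> fst C" using PT c by (auto simp: C_def tangent_chart_def)
  define V where "V = chart_image c"
  interpret smooth_metric_on_chart g c V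
    unfolding V_def using assms(1,2) c(1) by (rule smooth_metric_on_chart_image)
  interpret smooth_metric_on_surface_chart g c V ..
  interpret S: metric_on_chart "sasaki_metric M g" C "base_part -` V"
    unfolding C_def by (rule sasaki_metric_on_chart)
  define f where "f = transition b C"
  define U1 where "U1 = snd b ` (fst b \<inter> fst C)"
  have inj_b: "inj_on (snd b) (fst b)"
    using sub b by (auto simp: submanifold_def smooth_manifold_def)
  have U1: "open U1" "smooth_on U1 f" "\<And>y. y \<in> U1 \<Longrightarrow> inj (frechet_derivative f (at y))"
    using sub b C by (auto simp: submanifold_def U1_def f_def)
  have baseV: "base_part (f y) \<in> V" if "y \<in> U1" for y
    using transition_tangent_chart_base[OF inj_b, of y M c] that by (simp add: U1_def C_def f_def V_def)
  have C2: "C_k_on (Suc (Suc 0)) U1 f" using U1(2) unfolding smooth_on_def by blast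
  have f: "f differentiable (at y)" if "y \<in> U1" for y
    using C2 that by (rule C_k_on_imp_differentiable)
  have f': "(\<lambda>y. frechet_derivative f (at y) E) differentiable (at y)" if "y \<in> U1" for y E
    using C2 that by simp
  define y0 where "y0 = snd b P"
  have y0: "y0 \<in> U1" using P PC by (simp add: y0_def U1_def)
  have x0: "base_part (f y0) = snd c (fst P)"
    unfolding y0_def f_def C_def by (rule transition_tangent_chart_base_at[OF inj_b P])
  have curved0: "curvature_scalar (base_part (f y0)) \<noteq> 0"
  proof -
    have "gaussian_curvature M g (fst P) \<noteq> 0"
      using assms(3) Pc by (force simp: sign_preserving_curvature_def)
    then have "g c (snd c (fst P)) (riemann_curvature g c 1 2 2 (snd c (fst P))) (axis 1 1) \<noteq> 0"
      unfolding gaussian_curvature_def Let_def c_def[symmetric] by auto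
    then show ?thesis
      using riemann_curvature_eq_curvature[OF baseV[OF y0], of 1 2 2]
      by (simp add: x0 curvature_scalar_def rotation_def)
  qed
  define U2 where "U2 = {y \<in> U1. curvature_scalar (base_part (f y)) \<noteq> 0}"
  have "(\<lambda>y. curvature_scalar (base_part (f y))) differentiable (at y)" if y: "y \<in> U1" for y
    unfolding curvature_scalar_def rotation_def
    by (rule differentiableI[OF has_derivative[OF baseV[OF y] has_derivative_base[OF f[OF y]]
          curvature.has_derivative[OF baseV[OF y] has_derivative_base[OF f[OF y]] has_derivative_const has_derivative_const]
          has_derivative_const]])
  then have "continuous_on U1 (\<lambda>y. curvature_scalar (base_part (f y)))"
    by (auto intro!: differentiable_imp_continuous_on differentiable_at_imp_differentiable_on)
  then have U2: "open U2" "y0 \<in> U2" "U2 \<subseteq> U1"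
    using open_nonvanishing[OF U1(1)] y0 curved0 by (auto simp: U2_def)
  obtain U n where U: "open U" "y0 \<in> U" "U \<subseteq> U2"
    and n: "\<And>y. y \<in> U \<Longrightarrow> n differentiable (at y)"
      "\<And>y E. y \<in> U \<Longrightarrow> sasaki_metric M g C (f y) (frechet_derivative f (at y) E) (n y) = 0"
      "\<And>y. y \<in> U \<Longrightarrow> sasaki_metric M g C (f y) (n y) (n y) = 1"
  proof (rule S.unit_normal_field_ex[OF U2(1,2), of f])
    show "CARD(3) < CARD(2 + 2)" by simp
  qed (use U2 U1 baseV f f' in \<open>auto\<close>)
  have UU1: "y \<in> U1" if "y \<in> U" for y using that U U2 by blast
  define p where "p = (\<lambda>y. base_part (n y))"
  define q where "q = (\<lambda>y. connection_map g c (f y) (n y))"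
  interpret geodesic_hypersurface_over_surface g c V M U f p q
  proof
    show "open U" by (rule U(1))
    fix y assume y: "y \<in> U"
    note y1 = UU1[OF y]
    have fV: "f y \<in> base_part -` V" using baseV[OF y1] by simp
    show "base_part (f y) \<in> V" by (rule baseV[OF y1])
    show "f differentiable (at y)" by (rule f[OF y1])
    show "(\<lambda>y. frechet_derivative f (at y) E) differentiable (at y)" for E by (rule f'[OF y1])
    show "p differentiable (at y)"
      unfolding p_def
      by (rule differentiableI[OF has_derivative_base_part[OF n(1)[OF y, unfolded frechet_derivative_works]]])
    show "q differentiable (at y)"
      unfolding q_def
      by (rule differentiableI[OF has_derivative_connection[OF baseV[OF y1] f[OF y1, unfolded frechet_derivative_works]
              n(1)[OF y, unfolded frechet_derivative_works]]])
    show "g c (base_part (f y)) (horizontal_velocity f E y) (p y)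
      + g c (base_part (f y)) (vertical_velocity f E y) (q y) = 0" for E
      using n(2)[OF y, of E]
      by (simp add: C_def sasaki_metric_tangent_chart p_def q_def horizontal_velocity_def vertical_velocity_def)
    show "g c (base_part (f y)) (p y) (p y) + g c (base_part (f y)) (q y) (q y) = 1"
      using n(3)[OF y] by (simp add: C_def sasaki_metric_tangent_chart p_def q_def)
    show "curvature_scalar (base_part (f y)) \<noteq> 0" using y U by (auto simp: U2_def)
    show "\<exists>E t. u = horizontal_velocity f E y + t *\<^sub>R p y \<and> w = vertical_velocity f E y + t *\<^sub>R q y" for u w
    proof -
      \<comment> \<open>the vector with horizontal part u and vertical part w\<close>
      define v where "v = (\<chi> a. case a of Inl i \<Rightarrow> u $ i | Inr i \<Rightarrow> (w - christoffel_map g c (base_part (f y)) (fibre_part (f y)) u) $ i)"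
      have vb: "base_part v = u" by (simp add: v_def base_part_def vec_eq_iff)
      have "fibre_part v = w - christoffel_map g c (base_part (f y)) (fibre_part (f y)) u"
        by (simp add: v_def fibre_part_def vec_eq_iff)
      then have vk: "connection_map g c (f y) v = w" by (simp add: connection_map_eq vb)
      have "\<exists>E t. v = frechet_derivative f (at y) E + t *\<^sub>R n y"
        by (rule S.unit_normal_spanning[OF fV linear_frechet_derivative[OF f[OF y1]] U1(3)[OF y1] _ n(2)[OF y] n(3)[OF y]])
          simp
      then obtain E t where v: "v = frechet_derivative f (at y) E + t *\<^sub>R n y" by blast
      have "u = horizontal_velocity f E y + t *\<^sub>R p y"
        using vb by (simp add: v base_part_linear horizontal_velocity_def p_def)
      moreover have "w = vertical_velocity f E y + t *\<^sub>R q y"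
        using vk by (simp add: v linear_add[OF linear_connection] linear_cmul[OF linear_connection]
            vertical_velocity_def q_def)
      ultimately show ?thesis by blast
    qed
    fix \<nu> Q P'
    assume normal: "\<And>E. sasaki_metric M g (tangent_chart M c) (f y) (frechet_derivative f (at y) E) \<nu> = 0"
    have "normal_vector (sasaki_metric M g) b C y \<nu>"
      using normal by (simp add: normal_vector_def partial_def C_def f_def)
    then have sff: "second_fundamental_form (sasaki_metric M g) b C y \<nu> i j = 0" for i j
      using tg b C y1 unfolding totally_geodesic_def U1_def by blast
    have "ambient_derivative (sasaki_metric M g) b C i j y =
      partial i (partial j f) y + christoffel_map (sasaki_metric M g) C (f y) (partial i f y) (partial j f y)" for i j
      by (simp add: ambient_derivative_def christoffel_map_def f_def vec_eq_iff Let_def)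
    then have "sasaki_metric M g C (f y) (partial i (partial j f) y
      + christoffel_map (sasaki_metric M g) C (f y) (partial i f y) (partial j f y)) \<nu> = 0" for i j
      using sff[of i j] by (simp add: second_fundamental_form_def f_def)
    then show "sasaki_metric M g (tangent_chart M c) (f y)
      (frechet_derivative (\<lambda>y. frechet_derivative f (at y) Q) (at y) P'
        + christoffel_map (sasaki_metric M g) (tangent_chart M c) (f y)
            (frechet_derivative f (at y) P') (frechet_derivative f (at y) Q)) \<nu> = 0"
      using S.second_fundamental_form_directions[OF U1(1) y1 fV f f'[OF y1]] unfolding C_def by blast
  qed
  show False using no_parameters U(2) by blast
qed

end
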